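(* Let $G$ be an amenable group containing a countable uniform lattice, and let $\phi$, $\psi$ and $\rho$ be actions of $G$ on compact Hausdorff spaces $X$, $Y$ and $Z$ respectively. Let $\psi$ be a factor of $\phi$ via a factor map $p\colon X\to Y$ and let $\rho$ be a factor of $\psi$ via a factor map $q\colon Y\to Z$. Then $$\max\{\operatorname{E}(\phi\overset{p}{\to}\psi),\operatorname{E}(\psi\overset{q}{\to}\rho)\}\le\operatorname{E}(\phi\overset{q\circ p}{\to}\rho)\le\operatorname{E}(\phi\overset{p}{\to}\psi)+\operatorname{E}(\psi\overset{q}{\to}\rho).$$
   Context: Topological groups are assumed $T_1$ (hence Hausdorff). A locally compact group $G$ is unimodular if it admits a Haar measure, meaning a non-zero regular Borel measure $\mu$ with $\mu(gA)=\mu(A)=\mu(Ag)$ for all $g\in G$ and all Borel sets $A\subseteq G$; it is unique up to scaling and $\mu$ denotes a fixed one. For $A,B\subseteq G$ write $AB=\{ab: a\in A, b\in B\}$ and $A^c=G\setminus A$. For $K,A\subseteq G$ the $K$-boundary of $A$ is $\partial_K A:=K\overline{A}\cap K\overline{A^c}$. A directed set is a non-empty partially ordered set in which every finite subset has an upper bound; a net is a family indexed by a directed set. A net $(A_i)_{i\in I}$ of compact subsets of a unimodular group $G$ is a Van Hove net if there is $j\in I$ such that $A_i$ has non-empty interior for all $i\ge j$, and $\lim_{i\in I}\mu(\partial_K A_i)/\mu(A_i)=0$ for every compact $K\subseteq G$. An amenable group is a unimodular (locally compact) group that contains a Van Hove net. A uniform lattice in $G$ is a discrete subgroup $\Lambda$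 with $G/\Lambda$ compact. An action of $G$ on a topological space $X$ is a continuous map $\phi\colon G\times X\to X$ with $\phi(e_G,\cdot)=\mathrm{id}_X$ and $\phi(g,\phi(g',\cdot))=\phi(gg',\cdot)$; write $\phi^g=\phi(g,\cdot)$. If $\psi$ is an action of $G$ on $Y$, a factor map is a surjective continuous $p\colon X\to Y$ with $p\circ\phi^g=\psi^g\circ p$ for all $g\in G$; then $\psi$ is called a factor of $\phi$ via $p$. For a compact Hausdorff space $X$ the uniformity $\mathbb{U}_X$ is the set of all neighbourhoods of the diagonal in $X\times X$ (entourages). For $\eta\in\mathbb{U}_X$ and compact $A\subseteq G$ put $\eta_A:=\{(x,y):(\phi^g(x),\phi^g(y))\in\eta\ \text{for all } g\in A\}$, which is again an entourage. For $M\subseteq X$ and $\eta\in\mathbb{U}_X$, $\operatorname{cov}_M(\eta)$ is the minimal cardinality of a cover of $M$ by open sets $U$ with $U\times U\subseteq\eta$, and $\operatorname{cov}_p(\eta):=\sup_{y\in Y}\operatorname{cov}_{p^{-1}(y)}(\eta)$ for a map $p\colon X\to Y$. The relative topological entropy is $$\operatorname{E}(\phi\overset{p}{\to}\psi):=\sup_{\eta\in\mathbb{U}_X}\lim_{i\in I}\frac{\log(\operatorname{cov}_p(\eta_{A_i}))}{\mu(A_i)}\in[0,\infty]$$ for any Van Hove net $(A_i)_{i\in I}$ in $G$; for the groups considered here the limits exist, are finite and do not depend on the choice of the Van Hove net. *)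

theory Defs
  imports "HOL-Analysis.Analysis" "HOL-Library.Extended_Nat"
begin

text \<open>
  Topological groups are types of class \<open>topological_group_add\<close>, hence written additively,
  but \<open>+\<close> is not assumed to be commutative. The Hausdorff axiom is supplied by \<open>t2_space\<close>.
\<close>

subsection \<open>Haar measures, Van Hove nets and uniform lattices\<close>

definition regular_borel_measure :: "'a::topological_space measure \<Rightarrow> bool" where
  "regular_borel_measure \<mu> \<longleftrightarrow>
     sets \<mu> = sets borel \<and>
     (\<forall>K. compact K \<longrightarrow> emeasure \<mu> K < \<infinity>) \<and>
     (\<forall>B\<in>sets borel. emeasure \<mu> B = (INF U\<in>{U. open U \<and> B \<subseteq> U}. emeasure \<mu> U)) \<and>
     (\<forall>U. open U \<longrightarrow> emeasure \<mu> U = (SUP K\<in>{K. compact K \<and> K \<subseteq> U}. emeasure \<mu> K))"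

text \<open>Two-sided invariance: a locally compact group is unimodular iff such a measure exists.\<close>

definition haar_measure :: "'g::{topological_group_add, t2_space} measure \<Rightarrow> bool" where
  "haar_measure \<mu> \<longleftrightarrow>
     regular_borel_measure \<mu> \<and>
     emeasure \<mu> (space \<mu>) \<noteq> 0 \<and>
     (\<forall>g. \<forall>B\<in>sets borel. emeasure \<mu> ((\<lambda>x. g + x) ` B) = emeasure \<mu> B \<and>
                         emeasure \<mu> ((\<lambda>x. x + g) ` B) = emeasure \<mu> B)"

definition boundary :: "'g::{topological_group_add, t2_space} set \<Rightarrow> 'g set \<Rightarrow> 'g set" where
  "boundary K A = (K + closure A) \<inter> (K + closure (- A))"

text \<open>
  The index set is a whole type, so it is non-empty; directedness says that every finite
  subset of it has an upper bound.
\<close>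

definition van_hove_net ::
    "'g::{topological_group_add, t2_space} measure \<Rightarrow> ('i::order \<Rightarrow> 'g set) \<Rightarrow> bool" where
  "van_hove_net \<mu> A \<longleftrightarrow>
     (\<forall>J::'i set. finite J \<longrightarrow> bdd_above J) \<and>
     (\<forall>i. compact (A i)) \<and>
     (\<exists>j. \<forall>i\<ge>j. interior (A i) \<noteq> {}) \<and>
     (\<forall>K. compact K \<longrightarrow>
        ((\<lambda>i. measure \<mu> (boundary K (A i)) / measure \<mu> (A i)) \<longlongrightarrow> 0) at_top)"

definition add_subgroup :: "'g::group_add set \<Rightarrow> bool" where
  "add_subgroup H \<longleftrightarrow> 0 \<in> H \<and> (\<forall>x\<in>H. \<forall>y\<in>H. x + y \<in> H) \<and> (\<forall>x\<in>H. - x \<in> H)"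

definition left_coset_topology :: "'g::{topological_space, plus} set \<Rightarrow> 'g set topology" where
  "left_coset_topology H =
     topology (\<lambda>\<U>. \<U> \<subseteq> range (\<lambda>g. g +o H) \<and> open {g. g +o H \<in> \<U>})"

lemma openin_left_coset_topology:
  "openin (left_coset_topology H) \<U> \<longleftrightarrow>
     \<U> \<subseteq> range (\<lambda>g. g +o H) \<and> open {g. g +o H \<in> \<U>}"
proof -
  have "istopology (\<lambda>\<U>. \<U> \<subseteq> range (\<lambda>g. g +o H) \<and> open {g. g +o H \<in> \<U>})"
    unfolding istopology_def
  proof (intro conjI allI impI)
    fix S T
    assume S: "S \<subseteq> range (\<lambda>g. g +o H) \<and> open {g. g +o H \<in> S}"
      and T: "T \<subseteq> range (\<lambda>g. g +o H) \<and> open {g. g +o H \<in> T}"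
    have "{g. g +o H \<in> S \<inter> T} = {g. g +o H \<in> S} \<inter> {g. g +o H \<in> T}" by auto
    then show "open {g. g +o H \<in> S \<inter> T}" using S T by (simp add: open_Int)
    show "S \<inter> T \<subseteq> range (\<lambda>g. g +o H)" using S by blast
  next
    fix \<K>
    assume K: "\<forall>S\<in>\<K>. S \<subseteq> range (\<lambda>g. g +o H) \<and> open {g. g +o H \<in> S}"
    have "{g. g +o H \<in> \<Union>\<K>} = (\<Union>S\<in>\<K>. {g. g +o H \<in> S})" by auto
    moreover have "open (\<Union>S\<in>\<K>. {g. g +o H \<in> S})" using K by (intro open_UN) blast
    ultimately show "open {g. g +o H \<in> \<Union>\<K>}" by (simp only:)
    show "\<Union>\<K> \<subseteq> range (\<lambda>g. g +o H)" using K by blast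
  qed
  then show ?thesis
    unfolding left_coset_topology_def by (simp add: topology_inverse')
qed

lemma quotient_map_left_coset_topology:
  "quotient_map euclidean (left_coset_topology H) (\<lambda>g. g +o H)"
proof -
  have "topspace (left_coset_topology H) = range (\<lambda>g. g +o H)"
  proof (rule antisym)
    show "topspace (left_coset_topology H) \<subseteq> range (\<lambda>g. g +o H)"
      using openin_topspace openin_left_coset_topology by blast
    have "openin (left_coset_topology H) (range (\<lambda>g. g +o H))"
      by (simp add: openin_left_coset_topology)
    then show "range (\<lambda>g. g +o H) \<subseteq> topspace (left_coset_topology H)"
      by (rule openin_subset)
  qed
  then show ?thesis
    by (auto simp: quotient_map_def openin_left_coset_topology)
qed

definition uniform_lattice :: "'g::{topological_group_add, t2_space} set \<Rightarrow> bool" where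
  "uniform_lattice \<Lambda> \<longleftrightarrow>
     add_subgroup \<Lambda> \<and> discrete \<Lambda> \<and> compact_space (left_coset_topology \<Lambda>)"

subsection \<open>Actions and factor maps\<close>

definition top_action ::
    "('g::topological_group_add \<Rightarrow> 'x::topological_space \<Rightarrow> 'x) \<Rightarrow> bool" where
  "top_action \<phi> \<longleftrightarrow>
     continuous_on UNIV (\<lambda>(g, x). \<phi> g x) \<and>
     (\<forall>x. \<phi> 0 x = x) \<and>
     (\<forall>g g' x. \<phi> g (\<phi> g' x) = \<phi> (g + g') x)"

definition factor_map ::
    "('g \<Rightarrow> 'x::topological_space \<Rightarrow> 'x) \<Rightarrow> ('g \<Rightarrow> 'y::topological_space \<Rightarrow> 'y) \<Rightarrow>
     ('x \<Rightarrow> 'y) \<Rightarrow> bool" where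
  "factor_map \<phi> \<psi> p \<longleftrightarrow>
     continuous_on UNIV p \<and> surj p \<and> (\<forall>g. p \<circ> \<phi> g = \<psi> g \<circ> p)"

subsection \<open>Relative topological entropy\<close>

definition entourages :: "('x::topological_space \<times> 'x) set set" where
  "entourages = {\<eta>. \<exists>W. open W \<and> range (\<lambda>x. (x, x)) \<subseteq> W \<and> W \<subseteq> \<eta>}"

definition bowen_entourage ::
    "('g \<Rightarrow> 'x \<Rightarrow> 'x) \<Rightarrow> ('x \<times> 'x) set \<Rightarrow> 'g set \<Rightarrow> ('x \<times> 'x) set" where
  "bowen_entourage \<phi> \<eta> A = {(x, y). \<forall>g\<in>A. (\<phi> g x, \<phi> g y) \<in> \<eta>}"

text \<open>The value is \<open>\<infinity>\<close> (the infimum of the empty set) if there is no finite cover.\<close>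

definition cov :: "'x::topological_space set \<Rightarrow> ('x \<times> 'x) set \<Rightarrow> enat" where
  "cov M \<eta> = Inf {enat (card \<U>) | \<U>.
     finite \<U> \<and> M \<subseteq> \<Union>\<U> \<and> (\<forall>U\<in>\<U>. open U \<and> U \<times> U \<subseteq> \<eta>)}"

definition cov_map :: "('x::topological_space \<Rightarrow> 'y) \<Rightarrow> ('x \<times> 'x) set \<Rightarrow> enat" where
  "cov_map p \<eta> = (SUP y. cov (p -` {y}) \<eta>)"

definition log_enat :: "enat \<Rightarrow> ereal" where
  "log_enat n = (case n of enat k \<Rightarrow> if k = 0 then - \<infinity> else ereal (ln (real k)) | \<infinity> \<Rightarrow> \<infinity>)"

text \<open>
  The entropy of \<open>\<phi>\<close> relative to a factor via \<open>p\<close>, computed along the net \<open>A\<close>. The action on the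
  codomain of \<open>p\<close> is not an argument, as the value does not involve it.
\<close>

definition rel_entropy ::
    "'g::{topological_group_add, t2_space} measure \<Rightarrow> ('i::order \<Rightarrow> 'g set) \<Rightarrow>
     ('g \<Rightarrow> 'x::topological_space \<Rightarrow> 'x) \<Rightarrow> ('x \<Rightarrow> 'y) \<Rightarrow> ereal" where
  "rel_entropy \<mu> A \<phi> p =
     (SUP \<eta>\<in>entourages.
        Lim at_top (\<lambda>i. log_enat (cov_map p (bowen_entourage \<phi> \<eta> (A i))) / ereal (measure \<mu> (A i))))"

end

theory Submission
  imports Defs
begin

text \<open>
  Entropy is a supremum of limits along the Van Hove net, so the existence of these limits is
  part of the matter. The logarithm of the covering number \<open>cov_map p (bowen_entourage \<phi> \<eta> A)\<close> is,
  as a function of the compact set \<open>A\<close>, monotone, subadditive for unions and invariant under right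
  translation. The proof of convergence has two stages.

  On the lattice \<open>\<Lambda>\<close>, everything is counting. If \<open>f\<close> is subadditive and invariant on the finite
  subsets of \<open>\<Lambda>\<close>, then \<open>f F / |F|\<close> converges as \<open>F\<close> becomes more and more invariant
  (\<open>ornstein_weiss\<close>). Let \<open>L\<close> be the infimum of the asymptotic upper bounds of \<open>f F / |F|\<close>, and
  suppose that arbitrarily invariant sets \<open>K\<close> have \<open>f K / |K| \<le> l < L\<close>. A very invariant \<open>F\<close> then
  contains a union \<open>W\<close> of nearly disjoint translates of such a \<open>K\<close>. The union occupies a
  proportion of \<open>F\<close> that does not depend on \<open>K\<close>, and on \<open>W\<close> the ratio is essentially at most \<open>l\<close>.
  What remains of \<open>F\<close> is again invariant or negligible, so there the bound \<open>L\<close> applies.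
  Subadditivity gives a bound for \<open>F\<close> that is better than \<open>L\<close> by a fixed amount, a contradiction.

  From \<open>\<Lambda>\<close> the result passes to the whole group through a relatively compact Borel fundamental
  domain \<open>D\<close>, contained in a compact set \<open>C\<close>. A member \<open>A\<close> of the net is replaced by the set of all
  \<open>s \<in> \<Lambda>\<close> for which \<open>C + s\<close> meets \<open>A\<close>. The translates of \<open>D\<close> that lie across the edge of \<open>A\<close> are
  disjoint and contained in a boundary of \<open>A\<close>, so the Van Hove condition makes their number
  negligible, and limits along the net are limits over \<open>\<Lambda>\<close> divided by \<open>\<mu>(D)\<close> (\<open>van_hove_limit\<close>).

  Of the inequalities, \<open>E(p) \<le> E(q \<circ> p)\<close> holds because fibres of \<open>p\<close> are contained in fibres of
  \<open>q \<circ> p\<close>. For \<open>E(q) \<le> E(q \<circ> p)\<close>, the members of a cover in \<open>X\<close> are pushed forward by \<open>p\<close> and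
  thickened to become open, at the cost of passing to an entourage whose triple composition lies in
  the given one.

  For the upper bound, cover a fibre of \<open>q\<close> by sets that are small of order \<open>\<theta>\<close> along \<open>A\<close>, and cover
  the preimage of each of them, a tube around fibres of \<open>p\<close>. The number of sets needed for a tube
  must be compared with the number needed for a fibre. For one fixed compact set \<open>S\<close>, a small enough
  \<open>\<theta>\<close> makes them equal because \<open>p\<close> is a closed map, but \<open>\<theta>\<close> depends on \<open>S\<close>. This is why the
  Ornstein--Weiss lemma is proved for a downward directed family of functions
  (\<open>ornstein_weiss_family\<close>), here indexed by \<open>\<theta>\<close>: the argument above needs a good \<open>\<theta>\<close> only for the
  single set \<open>K\<close>, and it shows that the infimum over \<open>\<theta>\<close> of the growth rates of tubes is the growth
  rate of fibres (\<open>log_tube_cov_asymptotics\<close>).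
\<close>

section \<open>The Ornstein--Weiss lemma\<close>

text \<open>
  Only the points that translation moves out of \<open>F\<close> are counted, not the symmetric difference. For
  finite \<open>F\<close> as many points are missed as are added, which is what makes the defect of a set
  difference controllable.
\<close>
definition shift_defect :: "'g::group_add set \<Rightarrow> 'g set \<Rightarrow> nat" where
  "shift_defect T F = (\<Sum>t\<in>T. card ((+) t ` F - F))"

definition invariant_sets :: "'g::group_add set \<Rightarrow> 'g set \<Rightarrow> real \<Rightarrow> 'g set set" where
  "invariant_sets H T \<delta> =
     {F. finite F \<and> F \<noteq> {} \<and> F \<subseteq> H \<and> real (shift_defect T F) \<le> \<delta> * real (card F)}"

text \<open>
  Convergence along this filter is convergence as the finite sets become more and more invariant
  under left translation by \<open>H\<close>. For a subgroup \<open>H\<close>, the filter is trivial exactly if \<open>H\<close> is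
  not amenable.
\<close>
definition folner :: "'g::group_add set \<Rightarrow> 'g set filter" where
  "folner H = (INF (T, \<delta>)\<in>{(T, \<delta>). finite T \<and> T \<subseteq> H \<and> 0 < \<delta>}. principal (invariant_sets H T \<delta>))"

text \<open>
  The logarithmic covering numbers of fibres and of tubes have these properties; the latter need not be
  monotone, since shrinking a set makes its tubes wider.
\<close>
definition subadditive_invariant :: "'g::group_add set \<Rightarrow> ('g set \<Rightarrow> real) \<Rightarrow> bool" where
  "subadditive_invariant H f \<longleftrightarrow>
     f {} = 0 \<and>
     (\<forall>F. finite F \<longrightarrow> F \<subseteq> H \<longrightarrow> 0 \<le> f F) \<and>
     (\<forall>F G. finite F \<longrightarrow> finite G \<longrightarrow> F \<subseteq> H \<longrightarrow> G \<subseteq> H \<longrightarrow> f (F \<union> G) \<le> f F + f G) \<and>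
     (\<forall>F. \<forall>c\<in>H. finite F \<longrightarrow> F \<subseteq> H \<longrightarrow> f ((\<lambda>x. x + c) ` F) = f F)"

lemma subadditive_invariantD:
  assumes "subadditive_invariant H f"
  shows "f {} = 0"
    and "finite F \<Longrightarrow> F \<subseteq> H \<Longrightarrow> 0 \<le> f F"
    and "finite F \<Longrightarrow> finite G \<Longrightarrow> F \<subseteq> H \<Longrightarrow> G \<subseteq> H \<Longrightarrow> f (F \<union> G) \<le> f F + f G"
    and "c \<in> H \<Longrightarrow> finite F \<Longrightarrow> F \<subseteq> H \<Longrightarrow> f ((\<lambda>x. x + c) ` F) = f F"
  using assms unfolding subadditive_invariant_def by simp_all

lemma shift_defect_Un:
  assumes "finite F" "finite G"
  shows "shift_defect T (F \<union> G) \<le> shift_defect T F + shift_defect T G"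
proof -
  have "card ((+) t ` (F \<union> G) - (F \<union> G)) \<le> card ((+) t ` F - F) + card ((+) t ` G - G)" for t
  proof -
    have "card ((+) t ` (F \<union> G) - (F \<union> G)) \<le> card (((+) t ` F - F) \<union> ((+) t ` G - G))"
      using assms by (intro card_mono) auto
    also have "\<dots> \<le> card ((+) t ` F - F) + card ((+) t ` G - G)" by (rule card_Un_le)
    finally show ?thesis .
  qed
  then show ?thesis unfolding shift_defect_def by (simp add: sum_mono flip: sum.distrib)
qed

lemma shift_defect_Diff:
  assumes "finite F" "finite W"
  shows "shift_defect T (F - W) \<le> shift_defect T F + shift_defect T W"
proof -
  have "card ((+) t ` (F - W) - (F - W)) \<le> card ((+) t ` F - F) + card ((+) t ` W - W)" for t
  proof -
    have "card ((+) t ` (F - W) - (F - W)) \<le> card (((+) t ` F - F) \<union> (W - (+) t ` W))"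
      using assms by (intro card_mono) auto
    also have "\<dots> \<le> card ((+) t ` F - F) + card (W - (+) t ` W)" by (rule card_Un_le)
    also have "card (W - (+) t ` W) = card ((+) t ` W - W)"
    proof -
      have "card ((+) t ` W) = card W" by (rule card_image) simp
      then show ?thesis
        using assms by (simp add: card_Diff_subset_Int Int_commute)
    qed
    finally show ?thesis .
  qed
  then show ?thesis unfolding shift_defect_def by (simp add: sum_mono flip: sum.distrib)
qed

lemma shift_defect_translate: "shift_defect T ((\<lambda>x. x + c) ` F) = shift_defect T F"
proof -
  have "card ((+) t ` (\<lambda>x. x + c) ` F - (\<lambda>x. x + c) ` F) = card ((+) t ` F - F)" for t
  proof -
    have "(+) t ` (\<lambda>x. x + c) ` F - (\<lambda>x. x + c) ` F = (\<lambda>x. x + c) ` ((+) t ` F - F)"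
    proof -
      have "inj (\<lambda>x. x + c)" by (simp add: inj_on_def)
      then have "(\<lambda>x. x + c) ` ((+) t ` F - F) = (\<lambda>x. x + c) ` (+) t ` F - (\<lambda>x. x + c) ` F"
        by (rule image_set_diff)
      then show ?thesis by (simp add: image_image add.assoc)
    qed
    then show ?thesis by (simp add: card_image inj_on_def)
  qed
  then show ?thesis by (simp add: shift_defect_def)
qed

lemma shift_defect_mono: "finite T \<Longrightarrow> S \<subseteq> T \<Longrightarrow> shift_defect S F \<le> shift_defect T F"
  unfolding shift_defect_def by (rule sum_mono2) auto

lemma shift_defect_empty [simp]: "shift_defect T {} = 0"
  by (simp add: shift_defect_def)

lemma invariant_sets_mono:
  assumes "finite T" "S \<subseteq> T" "\<gamma> \<le> \<delta>"
  shows "invariant_sets H T \<gamma> \<subseteq> invariant_sets H S \<delta>"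
proof
  fix F assume F: "F \<in> invariant_sets H T \<gamma>"
  have "real (shift_defect S F) \<le> real (shift_defect T F)"
    using shift_defect_mono[OF assms(1,2)] by simp
  also have "\<dots> \<le> \<gamma> * real (card F)" using F by (simp add: invariant_sets_def)
  also have "\<dots> \<le> \<delta> * real (card F)" using assms by (simp add: mult_right_mono)
  finally show "F \<in> invariant_sets H S \<delta>" using F by (simp add: invariant_sets_def)
qed

lemma eventually_folner:
  "eventually P (folner H) \<longleftrightarrow>
     (\<exists>T \<delta>. finite T \<and> T \<subseteq> H \<and> 0 < \<delta> \<and> (\<forall>F\<in>invariant_sets H T \<delta>. P F))"
proof -
  let ?B = "{(T, \<delta>). finite T \<and> T \<subseteq> H \<and> 0 < (\<delta>::real)}"
  have "eventually P (folner H) \<longleftrightarrow>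
      (\<exists>b\<in>?B. eventually P (case b of (T, \<delta>) \<Rightarrow> principal (invariant_sets H T \<delta>)))"
    unfolding folner_def
  proof (rule eventually_INF_base)
    have "({}, 1) \<in> ?B" by simp
    then show "?B \<noteq> {}" by blast
  next
    fix a b assume ab: "a \<in> ?B" "b \<in> ?B"
    obtain T \<gamma> S \<delta> where eq: "a = (T, \<gamma>)" "b = (S, \<delta>)" by fastforce
    show "\<exists>x\<in>?B. (case x of (T, \<delta>) \<Rightarrow> principal (invariant_sets H T \<delta>)) \<le>
          inf (case a of (T, \<delta>) \<Rightarrow> principal (invariant_sets H T \<delta>))
              (case b of (T, \<delta>) \<Rightarrow> principal (invariant_sets H T \<delta>))"
    proof (rule bexI[where x = "(T \<union> S, min \<gamma> \<delta>)"])
      have "finite (T \<union> S)" using ab eq by simp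
      then show "(case (T \<union> S, min \<gamma> \<delta>) of (T, \<delta>) \<Rightarrow> principal (invariant_sets H T \<delta>)) \<le>
          inf (case a of (T, \<delta>) \<Rightarrow> principal (invariant_sets H T \<delta>))
              (case b of (T, \<delta>) \<Rightarrow> principal (invariant_sets H T \<delta>))"
        unfolding eq by (simp add: invariant_sets_mono)
    qed (use ab eq in auto)
  qed
  then show ?thesis by (auto simp: eventually_principal)
qed

lemma subadditive_invariant_le_card:
  assumes f: "subadditive_invariant H f" and H: "add_subgroup H"
    and "finite F" "F \<subseteq> H"
  shows "f F \<le> f {0} * real (card F)"
  using assms(3,4)
proof (induction F)
  case empty
  then show ?case using f by (simp add: subadditive_invariant_def)
next
  case (insert x F)
  have "f {x} = f ((\<lambda>y. y + x) ` {0})" by simp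
  also have "\<dots> = f {0}"
    using H insert.prems by (intro subadditive_invariantD(4)[OF f]) (auto simp: add_subgroup_def)
  finally have "f {x} = f {0}" .
  moreover have "f ({x} \<union> F) \<le> f {x} + f F"
    using insert.prems insert.hyps by (intro subadditive_invariantD(3)[OF f]) auto
  ultimately show ?case using insert by (simp add: algebra_simps)
qed

text \<open>
  The filling step. Translates of \<open>K\<close> inside \<open>F\<close> are collected as long as each new one meets the
  previous ones in at most the proportion \<open>\<epsilon>\<close>. Four properties of the union \<open>W\<close> are preserved by
  adding such a translate, so it suffices to take a set with these properties whose number \<open>m\<close> of
  translates is maximal. By maximality every translate of \<open>K\<close> inside \<open>F\<close> meets \<open>W\<close> in more than
  \<open>\<epsilon> |K|\<close> points, and counting incidences in two ways shows that \<open>|W|\<close> is at least \<open>\<epsilon>\<close>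
  times the number of these translates. Exactly disjoint ones would only give the factor \<open>1 / |K|\<close>.
\<close>
lemma maximal_almost_disjoint_translates:
  fixes \<epsilon> :: real
  assumes H: "add_subgroup H" and f: "subadditive_invariant H f"
    and K: "finite K" "K \<noteq> {}" "K \<subseteq> H" and F: "finite F" "F \<subseteq> H"
    and \<epsilon>: "0 < \<epsilon>" "\<epsilon> < 1"
  obtains W m where "W \<subseteq> F" "real m * (1 - \<epsilon>) * real (card K) \<le> real (card W)"
    "shift_defect T W \<le> m * shift_defect T K" "f W \<le> real m * f K"
    "\<epsilon> * real (card {c\<in>F. (\<lambda>k. k + c) ` K \<subseteq> F}) \<le> real (card W)"
proof -
  define P where "P W m \<longleftrightarrow> W \<subseteq> F \<and> real m * (1 - \<epsilon>) * real (card K) \<le> real (card W) \<and>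
    shift_defect T W \<le> m * shift_defect T K \<and> f W \<le> real m * f K" for W and m :: nat
  have K0: "0 < real (card K)" using K by (simp add: card_gt_0_iff)
  have "P {} 0" using f by (simp add: P_def subadditive_invariant_def)
  then have ex: "\<exists>W. P W 0" by blast
  have bd: "m \<le> nat \<lceil>real (card F) / ((1 - \<epsilon>) * real (card K))\<rceil>" if "P W m" for W m
  proof -
    have "real m * ((1 - \<epsilon>) * real (card K)) \<le> real (card W)"
      using that by (simp add: P_def mult.assoc)
    also have "\<dots> \<le> real (card F)" using that F by (auto simp: P_def intro: card_mono)
    finally have "real m \<le> real (card F) / ((1 - \<epsilon>) * real (card K))"
      using K0 \<epsilon> by (simp add: pos_le_divide_eq)
    then show ?thesis by linarith
  qed
  obtain m where m: "\<exists>W. P W m" and max: "\<And>n. \<exists>W. P W n \<Longrightarrow> n \<le> m"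
  proof -
    have "\<exists>m. (\<exists>W. P W m) \<and> (\<forall>n. (\<exists>W. P W n) \<longrightarrow> n \<le> m)"
      by (rule Nat.ex_has_greatest_nat[of "\<lambda>m. \<exists>W. P W m" 0, OF ex]) (use bd in blast)
    then show thesis using that by blast
  qed
  obtain W where W: "P W m" using m by blast
  have WF: "W \<subseteq> F" and finW: "finite W" using W F by (auto simp: P_def intro: finite_subset)
  define E where "E = {c\<in>F. (\<lambda>k. k + c) ` K \<subseteq> F}"
  have finE: "finite E" using F by (simp add: E_def)
  have hit: "\<epsilon> * real (card K) \<le> real (card {k\<in>K. k + c \<in> W})" if c: "c \<in> E" for c
  proof (rule ccontr)
    assume "\<not> ?thesis"
    then have less: "real (card {k\<in>K. k + c \<in> W}) < \<epsilon> * real (card K)" by simp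
    let ?Kc = "(\<lambda>k. k + c) ` K"
    have Kc: "?Kc \<subseteq> F" "c \<in> H" using c F by (auto simp: E_def)
    have "card (?Kc \<inter> W) = card {k\<in>K. k + c \<in> W}"
    proof -
      have "?Kc \<inter> W = (\<lambda>k. k + c) ` {k\<in>K. k + c \<in> W}" by blast
      then show ?thesis by (simp add: card_image inj_on_def)
    qed
    moreover have "card ?Kc = card K" by (simp add: card_image inj_on_def)
    moreover have "card (?Kc \<union> W) + card (?Kc \<inter> W) = card ?Kc + card W"
      using card_Un_Int[of ?Kc W] K finW by simp
    ultimately have "real (card (?Kc \<union> W)) \<ge> real (card K) + real (card W) - \<epsilon> * real (card K)"
      using less by linarith
    then have 1: "real (Suc m) * (1 - \<epsilon>) * real (card K) \<le> real (card (?Kc \<union> W))"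
      using W by (simp add: P_def algebra_simps)
    have 2: "shift_defect T (?Kc \<union> W) \<le> Suc m * shift_defect T K"
      using shift_defect_Un[of ?Kc W T] W K finW by (simp add: P_def shift_defect_translate)
    have "f (?Kc \<union> W) \<le> f ?Kc + f W"
      using K finW Kc F WF by (intro subadditive_invariantD(3)[OF f]) auto
    moreover have "f ?Kc = f K" using K Kc by (intro subadditive_invariantD(4)[OF f])
    ultimately have "f (?Kc \<union> W) \<le> real (Suc m) * f K" using W by (simp add: P_def algebra_simps)
    with 1 2 Kc WF have "P (?Kc \<union> W) (Suc m)" by (simp add: P_def)
    then show False using max[of "Suc m"] by auto
  qed
  have "\<epsilon> * real (card K) * real (card E) \<le> (\<Sum>c\<in>E. real (card {k\<in>K. k + c \<in> W}))"
    using sum_bounded_below[of E "\<epsilon> * real (card K)" "\<lambda>c. real (card {k\<in>K. k + c \<in> W})"] hit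
    by (simp add: mult.commute)
  also have "\<dots> = (\<Sum>c\<in>E. \<Sum>k\<in>K. if k + c \<in> W then 1 else 0)"
    using K by (simp add: sum.If_cases Int_def)
  also have "\<dots> = (\<Sum>k\<in>K. \<Sum>c\<in>E. if k + c \<in> W then 1 else 0)" by (rule sum.swap)
  also have "\<dots> = (\<Sum>k\<in>K. real (card {c\<in>E. k + c \<in> W}))"
    using finE by (simp add: sum.If_cases Int_def)
  also have "\<dots> \<le> (\<Sum>k\<in>K. real (card W))"
  proof (rule sum_mono)
    fix k
    have "card {c\<in>E. k + c \<in> W} = card ((+) k ` {c\<in>E. k + c \<in> W})"
      by (simp add: card_image)
    also have "\<dots> \<le> card W" using finW by (intro card_mono) auto
    finally show "real (card {c\<in>E. k + c \<in> W}) \<le> real (card W)" by simp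
  qed
  finally have "real (card K) * (\<epsilon> * real (card E)) \<le> real (card K) * real (card W)"
    by (simp add: mult_ac)
  then have "\<epsilon> * real (card E) \<le> real (card W)" using K0 by simp
  then show thesis using that[of W m] W unfolding P_def E_def by blast
qed

lemma card_translates_inside:
  assumes "finite F" "finite K"
  shows "card F \<le> card {c\<in>F. (\<lambda>k. k + c) ` K \<subseteq> F} + shift_defect K F"
proof -
  have "F \<subseteq> {c\<in>F. (\<lambda>k. k + c) ` K \<subseteq> F} \<union> (\<Union>k\<in>K. {c\<in>F. k + c \<notin> F})" by auto
  then have "card F \<le> card ({c\<in>F. (\<lambda>k. k + c) ` K \<subseteq> F} \<union> (\<Union>k\<in>K. {c\<in>F. k + c \<notin> F}))"
    using assms by (intro card_mono) auto
  also have "\<dots> \<le> card {c\<in>F. (\<lambda>k. k + c) ` K \<subseteq> F} + card (\<Union>k\<in>K. {c\<in>F. k + c \<notin> F})"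
    by (rule card_Un_le)
  also have "card (\<Union>k\<in>K. {c\<in>F. k + c \<notin> F}) \<le> (\<Sum>k\<in>K. card {c\<in>F. k + c \<notin> F})"
    using assms by (intro card_UN_le)
  also have "(\<Sum>k\<in>K. card {c\<in>F. k + c \<notin> F}) = shift_defect K F"
    unfolding shift_defect_def
  proof (rule sum.cong)
    fix k
    have "(+) k ` F - F = (+) k ` {c\<in>F. k + c \<notin> F}" by auto
    then show "card {c\<in>F. k + c \<notin> F} = card ((+) k ` F - F)" by (simp add: card_image)
  qed simp
  finally show ?thesis by simp
qed

text \<open>
  The gain from one round of filling. If sets that are \<open>(T, \<delta>)\<close>-invariant satisfy the bound \<open>a\<close> and a
  very invariant \<open>K\<close> satisfies the bound \<open>l\<close>, then \<open>F\<close> satisfies \<open>a\<close> minus a multiple of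
  \<open>a - l / (1 - \<epsilon>)\<close>, the gain on the at least \<open>\<epsilon> / 2\<close> of \<open>F\<close> that is filled. The set \<open>K\<close> enters neither the
  multiple nor the error term \<open>f {0} * \<epsilon>'\<close>; that term pays for the case that the unfilled part is
  too small to inherit invariance.
\<close>
lemma quasitiling_bound:
  fixes \<epsilon> a l \<epsilon>' \<delta> :: real
  assumes H: "add_subgroup H" and f: "subadditive_invariant H f"
    and \<epsilon>: "0 < \<epsilon>" "\<epsilon> < 1" and \<epsilon>': "0 < \<epsilon>'" and \<delta>: "0 < \<delta>"
    and a: "0 \<le> a" "l \<le> a * (1 - \<epsilon>)" and l: "0 \<le> l"
    and T: "finite T"
    and fT: "\<And>R. R \<in> invariant_sets H T \<delta> \<Longrightarrow> f R \<le> a * real (card R)"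
    and K: "K \<in> invariant_sets H T (\<delta> * \<epsilon>' * (1 - \<epsilon>) / 2)" "f K \<le> l * real (card K)"
    and F: "F \<in> invariant_sets H (T \<union> K) (min (1/2) (\<delta> * \<epsilon>' / 2))"
  shows "f F \<le> (a + f {0} * \<epsilon>' - \<epsilon> / 2 * (a - l / (1 - \<epsilon>))) * real (card F)"
proof -
  have finK: "finite K" "K \<noteq> {}" "K \<subseteq> H" and finF: "finite F" "F \<noteq> {}" "F \<subseteq> H"
    using K F by (auto simp: invariant_sets_def)
  obtain W m where WF: "W \<subseteq> F" and m: "real m * (1 - \<epsilon>) * real (card K) \<le> real (card W)"
    and dW: "shift_defect T W \<le> m * shift_defect T K" and fW: "f W \<le> real m * f K"
    and WE: "\<epsilon> * real (card {c\<in>F. (\<lambda>k. k + c) ` K \<subseteq> F}) \<le> real (card W)"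
    by (rule maximal_almost_disjoint_translates[OF H f finK finF(1,3) \<epsilon>])
  have finW: "finite W" "W \<subseteq> H" using WF finF by (auto intro: finite_subset)
  have mK: "real m * real (card K) \<le> real (card W) / (1 - \<epsilon>)"
    using m \<epsilon> by (simp add: pos_le_divide_eq mult_ac)
  have "real (shift_defect K F) \<le> real (shift_defect (T \<union> K) F)"
    using shift_defect_mono[of "T \<union> K" K F] T finK by simp
  also have "\<dots> \<le> min (1/2) (\<delta> * \<epsilon>' / 2) * real (card F)" using F by (simp add: invariant_sets_def)
  also have "\<dots> \<le> 1/2 * real (card F)" by (rule mult_right_mono) auto
  finally have "real (card F) / 2 \<le> real (card {c\<in>F. (\<lambda>k. k + c) ` K \<subseteq> F})"
    using card_translates_inside[OF finF(1) finK(1)] by linarith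
  then have "\<epsilon> * (real (card F) / 2) \<le> \<epsilon> * real (card {c\<in>F. (\<lambda>k. k + c) ` K \<subseteq> F})"
    using \<epsilon> by (intro mult_left_mono) auto
  with WE have Wbig: "\<epsilon> / 2 * real (card F) \<le> real (card W)" by simp
  have cardD: "real (card (F - W)) = real (card F) - real (card W)"
    using WF finF finW by (simp add: card_Diff_subset card_mono of_nat_diff)
  \<comment> \<open>If the rest is a definite part of \<open>F\<close>, it inherits \<open>(T, \<delta>)\<close>-invariance; otherwise the
      trivial bound suffices.\<close>
  have rest: "f (F - W) \<le> a * real (card (F - W)) + f {0} * \<epsilon>' * real (card F)"
  proof (cases "\<epsilon>' * real (card F) \<le> real (card (F - W))")
    case False
    have "f (F - W) \<le> f {0} * real (card (F - W))"
      using finF by (intro subadditive_invariant_le_card[OF f H]) auto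
    also have "\<dots> \<le> f {0} * (\<epsilon>' * real (card F))"
      using False f H by (intro mult_left_mono) (auto simp: subadditive_invariant_def add_subgroup_def)
    finally show ?thesis using a by (simp add: mult_ac add_increasing)
  next
    case True
    have "0 < \<epsilon>' * real (card F)" using \<epsilon>' finF by (simp add: card_gt_0_iff)
    then have "0 < real (card (F - W))" using True by linarith
    then have ne: "F - W \<noteq> {}" by force
    have "real (shift_defect T F) \<le> real (shift_defect (T \<union> K) F)"
      using shift_defect_mono[of "T \<union> K" T F] T finK by simp
    also have "\<dots> \<le> min (1/2) (\<delta> * \<epsilon>' / 2) * real (card F)" using F by (simp add: invariant_sets_def)
    also have "\<dots> \<le> \<delta> * \<epsilon>' / 2 * real (card F)" by (rule mult_right_mono) auto
    finally have 1: "real (shift_defect T F) \<le> \<delta> * \<epsilon>' / 2 * real (card F)" .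
    have "real (shift_defect T W) \<le> real m * real (shift_defect T K)"
      using dW by (metis of_nat_le_iff of_nat_mult)
    also have "\<dots> \<le> real m * (\<delta> * \<epsilon>' * (1 - \<epsilon>) / 2 * real (card K))"
      using K by (intro mult_left_mono) (auto simp: invariant_sets_def)
    also have "\<dots> = \<delta> * \<epsilon>' / 2 * (real m * (1 - \<epsilon>) * real (card K))" by (simp add: field_simps)
    also have "\<dots> \<le> \<delta> * \<epsilon>' / 2 * real (card F)"
    proof (rule mult_left_mono)
      show "real m * (1 - \<epsilon>) * real (card K) \<le> real (card F)"
        using m card_mono[OF finF(1) WF] by linarith
    qed (use \<delta> \<epsilon>' in auto)
    finally have "real (shift_defect T (F - W)) \<le>
        \<delta> * \<epsilon>' / 2 * real (card F) + \<delta> * \<epsilon>' / 2 * real (card F)"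
      using 1 shift_defect_Diff[OF finF(1) finW(1), of T] by linarith
    also have "\<dots> = \<delta> * (\<epsilon>' * real (card F))" by (simp add: field_simps)
    also have "\<dots> \<le> \<delta> * real (card (F - W))" using True \<delta> by (intro mult_left_mono) auto
    finally have "F - W \<in> invariant_sets H T \<delta>" using ne finF by (auto simp: invariant_sets_def)
    then have "f (F - W) \<le> a * real (card (F - W))" by (rule fT)
    moreover have "0 \<le> f {0} * \<epsilon>' * real (card F)"
      using f H \<epsilon>' by (auto simp: subadditive_invariant_def add_subgroup_def)
    ultimately show ?thesis by linarith
  qed
  have "f W \<le> real m * (l * real (card K))" using fW K(2) by (meson mult_left_mono of_nat_0_le_iff order_trans)
  also have "\<dots> = l * (real m * real (card K))" by (simp add: mult_ac)
  also have "\<dots> \<le> l * (real (card W) / (1 - \<epsilon>))" using mK l by (rule mult_left_mono)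
  finally have fW': "f W \<le> l / (1 - \<epsilon>) * real (card W)" by simp
  have "f F = f (W \<union> (F - W))" using WF by (simp add: Un_absorb1)
  also have "\<dots> \<le> f W + f (F - W)"
    using finW finF by (intro subadditive_invariantD(3)[OF f]) auto
  also have "\<dots> \<le> (a + f {0} * \<epsilon>') * real (card F) - (a - l / (1 - \<epsilon>)) * real (card W)"
    using fW' rest cardD by (simp add: algebra_simps)
  also have "\<dots> \<le> (a + f {0} * \<epsilon>') * real (card F) - (a - l / (1 - \<epsilon>)) * (\<epsilon> / 2 * real (card F))"
  proof -
    have "0 \<le> a - l / (1 - \<epsilon>)" using a \<epsilon> by (simp add: pos_divide_le_eq)
    then show ?thesis using mult_left_mono[OF Wbig, of "a - l / (1 - \<epsilon>)"] by linarith
  qed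
  also have "\<dots> = (a + f {0} * \<epsilon>' - \<epsilon> / 2 * (a - l / (1 - \<epsilon>))) * real (card F)"
    by (simp only: left_diff_distrib mult.assoc mult.left_commute[of _ "\<epsilon> / 2"])
  finally show ?thesis .
qed

text \<open>
  The number \<open>L\<close> is the infimum of the asymptotic upper bounds of all members of the family. Suppose
  that some \<open>l < L\<close> is attained on arbitrarily invariant sets. The function that attains it may vary
  with the set \<open>K\<close>; directedness provides a member of the family below that function, below one with
  an asymptotic upper bound \<open>a\<close> close to \<open>L\<close>, and below a fixed one that controls the error
  term. For this member \<open>quasitiling_bound\<close> gives an asymptotic upper bound smaller than \<open>L\<close>.
\<close>
theorem ornstein_weiss_family:
  assumes H: "add_subgroup H" and ne: "\<F> \<noteq> {}"
    and sub: "\<And>f. f \<in> \<F> \<Longrightarrow> subadditive_invariant H f"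
    and dir: "\<And>f g. f \<in> \<F> \<Longrightarrow> g \<in> \<F> \<Longrightarrow>
      \<exists>h\<in>\<F>. \<forall>F. finite F \<longrightarrow> F \<subseteq> H \<longrightarrow> h F \<le> f F \<and> h F \<le> g F"
  obtains L :: real where
    "\<And>a. L < a \<Longrightarrow> \<exists>f\<in>\<F>. eventually (\<lambda>F. f F \<le> a * real (card F)) (folner H)"
    "\<And>l. l < L \<Longrightarrow> eventually (\<lambda>F. \<forall>f\<in>\<F>. l * real (card F) < f F) (folner H)"
proof (cases "folner H = bot")
  case True
  then show thesis using that[of 0] ne by auto
next
  case nontriv: False
  define S where "S = {a. \<exists>f\<in>\<F>. eventually (\<lambda>F. f F \<le> a * real (card F)) (folner H)}"
  have ev_sets: "eventually (\<lambda>F. finite F \<and> F \<subseteq> H \<and> F \<noteq> {}) (folner H)"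
    unfolding eventually_folner
    by (rule exI[of _ "{}"], rule exI[of _ 1]) (auto simp: invariant_sets_def)
  obtain f0 where f0: "f0 \<in> \<F>" using ne by blast
  have H0: "0 \<in> H" using H by (simp add: add_subgroup_def)
  have "eventually (\<lambda>F. f0 F \<le> f0 {0} * real (card F)) (folner H)"
    using ev_sets by (rule eventually_mono) (blast intro: subadditive_invariant_le_card[OF sub[OF f0] H])
  then have S0: "f0 {0} \<in> S" using f0 by (auto simp: S_def)
  have Spos: "0 \<le> a" if a: "a \<in> S" for a
  proof -
    obtain f where f: "f \<in> \<F>" "eventually (\<lambda>F. f F \<le> a * real (card F)) (folner H)"
      using a by (auto simp: S_def)
    obtain F where F: "finite F" "F \<subseteq> H" "F \<noteq> {}" "f F \<le> a * real (card F)"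
      using eventually_happens'[OF nontriv eventually_conj[OF ev_sets f(2)]] by auto
    have "0 \<le> f F" using sub[OF f(1)] F by (simp add: subadditive_invariant_def)
    then have "0 \<le> a * real (card F)" using F by linarith
    moreover have "0 < real (card F)" using F by (simp add: card_gt_0_iff)
    ultimately show ?thesis by (simp add: zero_le_mult_iff)
  qed
  have bdd: "bdd_below S" using Spos by (auto simp: bdd_below_def)
  define L where "L = Inf S"
  have L0: "0 \<le> L" unfolding L_def using S0 Spos by (intro cInf_greatest) auto
  have up: "\<exists>f\<in>\<F>. eventually (\<lambda>F. f F \<le> a * real (card F)) (folner H)" if a: "L < a" for a
  proof -
    obtain b where b: "b \<in> S" "b < a" using a S0 cInf_lessD[of S a] by (auto simp: L_def)
    obtain f where f: "f \<in> \<F>" "eventually (\<lambda>F. f F \<le> b * real (card F)) (folner H)"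
      using b by (auto simp: S_def)
    have "eventually (\<lambda>F. f F \<le> a * real (card F)) (folner H)"
      using f(2) by (rule eventually_mono) (meson b(2) less_imp_le mult_right_mono of_nat_0_le_iff order_trans)
    then show ?thesis using f by blast
  qed
  moreover have "eventually (\<lambda>F. \<forall>f\<in>\<F>. l * real (card F) < f F) (folner H)" if lL: "l < L" for l
  proof (rule ccontr)
    assume not: "\<not> ?thesis"
    have low: "\<exists>K\<in>invariant_sets H T \<delta>. \<exists>f\<in>\<F>. f K \<le> l * real (card K)"
      if "finite T" "T \<subseteq> H" "0 < \<delta>" for T \<delta>
      using not that unfolding eventually_folner by (meson not_le_imp_less)
    have l0: "0 \<le> l"
    proof -
      obtain K f where K: "K \<in> invariant_sets H {} 1" "f \<in> \<F>" "f K \<le> l * real (card K)"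
        using low[of "{}" 1] by auto
      then have "0 \<le> f K" using sub[OF K(2)] by (simp add: subadditive_invariant_def invariant_sets_def)
      then have "0 \<le> l * real (card K)" using K by linarith
      moreover have "0 < real (card K)" using K by (simp add: card_gt_0_iff invariant_sets_def)
      ultimately show ?thesis by (simp add: zero_le_mult_iff)
    qed
    have Lpos: "0 < L" using l0 lL by simp
    \<comment> \<open>Chosen such that overlaps of proportion \<open>\<epsilon>\<close> do not use up the gap between \<open>l\<close> and \<open>L\<close>. The gain
          is then \<open>\<epsilon> g / 2\<close>; the slack \<open>a - L\<close> and the error term are each made at most \<open>\<epsilon> g / 8\<close>.\<close>
    define \<epsilon> where "\<epsilon> = (L - l) / (2 * L)"
    have \<epsilon>: "0 < \<epsilon>" "\<epsilon> < 1" using lL l0 Lpos by (auto simp: \<epsilon>_def divide_simps)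
    have gap: "l < L * (1 - \<epsilon>)" using lL Lpos by (simp add: \<epsilon>_def field_simps)
    define g where "g = L - l / (1 - \<epsilon>)"
    have g: "0 < g" using gap \<epsilon> by (simp add: g_def pos_divide_less_eq)
    define M where "M = f0 {0}"
    have M: "0 \<le> M" using Spos[OF S0] by (simp add: M_def)
    define \<epsilon>' where "\<epsilon>' = \<epsilon> * g / (8 * (M + 1))"
    have \<epsilon>': "0 < \<epsilon>'" using \<epsilon> g M by (simp add: \<epsilon>'_def)
    have "M * \<epsilon>' \<le> (M + 1) * \<epsilon>'" using \<epsilon>' by (simp add: mult_right_mono)
    also have "\<dots> = \<epsilon> * g / 8" using M by (simp add: \<epsilon>'_def field_simps)
    finally have M\<epsilon>': "M * \<epsilon>' \<le> \<epsilon> * g / 8" .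
    define a where "a = L + \<epsilon> * g / 8"
    have aL: "L < a" using \<epsilon> g by (simp add: a_def)
    obtain f1 where f1: "f1 \<in> \<F>" "eventually (\<lambda>F. f1 F \<le> a * real (card F)) (folner H)"
      using up[OF aL] by blast
    then obtain T \<delta> where T: "finite T" "T \<subseteq> H" "0 < \<delta>"
      and fT: "\<And>R. R \<in> invariant_sets H T \<delta> \<Longrightarrow> f1 R \<le> a * real (card R)"
      unfolding eventually_folner by blast
    have "0 < \<delta> * \<epsilon>' * (1 - \<epsilon>) / 2" using T \<epsilon> \<epsilon>' by simp
    then obtain K f2 where K: "K \<in> invariant_sets H T (\<delta> * \<epsilon>' * (1 - \<epsilon>) / 2)"
      "f2 \<in> \<F>" "f2 K \<le> l * real (card K)"
      using low[OF T(1,2)] by blast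
    obtain f3 where f3: "f3 \<in> \<F>" "\<And>F. finite F \<Longrightarrow> F \<subseteq> H \<Longrightarrow> f3 F \<le> f1 F \<and> f3 F \<le> f2 F"
      using dir[OF f1(1) K(2)] by blast
    obtain f where f: "f \<in> \<F>" "\<And>F. finite F \<Longrightarrow> F \<subseteq> H \<Longrightarrow> f F \<le> f3 F \<and> f F \<le> f0 F"
      using dir[OF f3(1) f0] by blast
    have f_le: "f F \<le> f1 F" "f F \<le> f2 F" if "finite F" "F \<subseteq> H" for F
      using f3(2)[OF that] f(2)[OF that] by linarith+
    have fM: "f {0} \<le> M" using f(2)[of "{0}"] H0 by (simp add: M_def)
    have bound: "f F \<le> (L - \<epsilon> * g / 8) * real (card F)"
      if F: "F \<in> invariant_sets H (T \<union> K) (min (1/2) (\<delta> * \<epsilon>' / 2))" for F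
    proof -
      have "f F \<le> (a + f {0} * \<epsilon>' - \<epsilon> / 2 * (a - l / (1 - \<epsilon>))) * real (card F)"
      proof (rule quasitiling_bound[OF H sub[OF f(1)] \<epsilon> \<epsilon>' T(3) _ _ l0 T(1) _ K(1) _ F])
        show "0 \<le> a" using aL L0 by simp
        have "l \<le> L * (1 - \<epsilon>)" using gap by simp
        also have "\<dots> \<le> a * (1 - \<epsilon>)" using aL \<epsilon> by (intro mult_right_mono) auto
        finally show "l \<le> a * (1 - \<epsilon>)" .
      next
        fix R assume R: "R \<in> invariant_sets H T \<delta>"
        then have "f R \<le> f1 R" by (intro f_le) (auto simp: invariant_sets_def)
        then show "f R \<le> a * real (card R)" using fT[OF R] by linarith
      next
        have "f K \<le> f2 K" using K by (intro f_le) (auto simp: invariant_sets_def)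
        then show "f K \<le> l * real (card K)" using K by linarith
      qed
      also have "\<dots> \<le> (L - \<epsilon> * g / 8) * real (card F)"
      proof (rule mult_right_mono)
        have "f {0} * \<epsilon>' \<le> \<epsilon> * g / 8"
          using fM \<epsilon>' M\<epsilon>' by (meson less_imp_le mult_right_mono order_trans)
        moreover have "\<epsilon> / 2 * (a - l / (1 - \<epsilon>)) \<ge> \<epsilon> / 2 * g"
          using aL \<epsilon> by (intro mult_left_mono) (auto simp: g_def)
        ultimately show "a + f {0} * \<epsilon>' - \<epsilon> / 2 * (a - l / (1 - \<epsilon>)) \<le> L - \<epsilon> * g / 8"
          using a_def mult_pos_pos[OF \<epsilon>(1) g] by linarith
      qed simp
      finally show ?thesis .
    qed
    have "eventually (\<lambda>F. f F \<le> (L - \<epsilon> * g / 8) * real (card F)) (folner H)"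
      unfolding eventually_folner
    proof (intro exI conjI ballI)
      show "finite (T \<union> K)" "T \<union> K \<subseteq> H" using T K by (auto simp: invariant_sets_def)
      show "0 < min (1/2) (\<delta> * \<epsilon>' / 2)" using T \<epsilon>' by simp
    qed (rule bound)
    then have "L - \<epsilon> * g / 8 \<in> S" using f by (auto simp: S_def)
    then have "L \<le> L - \<epsilon> * g / 8" unfolding L_def using bdd by (intro cInf_lower)
    then show False using mult_pos_pos[OF \<epsilon>(1) g] by simp
  qed
  ultimately show thesis by (rule that)
qed

corollary ornstein_weiss:
  assumes H: "add_subgroup H" and f: "subadditive_invariant H f"
  obtains L where "((\<lambda>F. f F / real (card F)) \<longlongrightarrow> L) (folner H)"
proof -
  obtain L where up: "\<And>a. L < a \<Longrightarrow> \<exists>f\<in>{f}. eventually (\<lambda>F. f F \<le> a * real (card F)) (folner H)"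
    and low: "\<And>l. l < L \<Longrightarrow> eventually (\<lambda>F. \<forall>f\<in>{f}. l * real (card F) < f F) (folner H)"
    by (rule ornstein_weiss_family[OF H, of "{f}"]) (use f in auto)
  have ev_sets: "eventually (\<lambda>F. 0 < real (card F)) (folner H)"
    unfolding eventually_folner
    by (rule exI[of _ "{}"], rule exI[of _ 1]) (auto simp: invariant_sets_def card_gt_0_iff)
  have "((\<lambda>F. f F / real (card F)) \<longlongrightarrow> L) (folner H)"
  proof (rule order_tendstoI)
    fix l assume "l < L"
    then have "eventually (\<lambda>F. \<forall>f\<in>{f}. l * real (card F) < f F) (folner H)" by (rule low)
    with ev_sets show "eventually (\<lambda>F. l < f F / real (card F)) (folner H)"
      by eventually_elim (simp add: pos_less_divide_eq)
  next
    fix a assume "L < a"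
    then have "L < (L + a) / 2" "(L + a) / 2 < a" by auto
    then have "eventually (\<lambda>F. f F \<le> (L + a) / 2 * real (card F)) (folner H)"
      using up[of "(L + a) / 2"] by auto
    with ev_sets show "eventually (\<lambda>F. f F / real (card F) < a) (folner H)"
    proof eventually_elim
      case (elim F)
      then have "f F / real (card F) \<le> (L + a) / 2" by (simp add: pos_divide_le_eq)
      then show ?case using \<open>(L + a) / 2 < a\<close> by linarith
    qed
  qed
  then show thesis by (rule that)
qed

section \<open>Haar measure and fundamental domains of uniform lattices\<close>

text \<open>
  The tube lemma. It makes \<open>K + B\<close> closed for compact \<open>K\<close> and closed \<open>B\<close>, and makes
  \<open>bowen_entourage \<phi> \<eta> A\<close> an entourage for compact \<open>A\<close>.
\<close>
lemma open_forall_compact: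
  fixes S :: "('a::topological_space \<times> 'b::topological_space) set"
  assumes K: "compact K" and S: "open S"
  shows "open {y. \<forall>k\<in>K. (k, y) \<in> S}"
proof (subst open_subopen, intro ballI)
  fix y assume y: "y \<in> {y. \<forall>k\<in>K. (k, y) \<in> S}"
  have "\<exists>U V. open U \<and> open V \<and> k \<in> U \<and> y \<in> V \<and> U \<times> V \<subseteq> S" if "k \<in> K" for k
  proof -
    have "(k, y) \<in> S" using y that by blast
    then obtain U V where "open U" "open V" "(k, y) \<in> U \<times> V" "U \<times> V \<subseteq> S"
      using open_prod_elim[OF S] by metis
    then show ?thesis by (metis mem_Times_iff fst_conv snd_conv)
  qed
  then obtain U V where UV: "\<And>k. k \<in> K \<Longrightarrow> open (U k) \<and> open (V k) \<and> k \<in> U k \<and> y \<in> V k \<and> U k \<times> V k \<subseteq> S"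
    by metis
  have "K \<subseteq> (\<Union>k\<in>K. U k)" using UV by blast
  then obtain J where J: "J \<subseteq> K" "finite J" "K \<subseteq> (\<Union>k\<in>J. U k)"
    using compactE_image[OF K, of K U] UV by metis
  have "open (\<Inter>k\<in>J. V k)" using J UV by (intro open_INT) auto
  moreover have "y \<in> (\<Inter>k\<in>J. V k)" using J UV by auto
  moreover have "(\<Inter>k\<in>J. V k) \<subseteq> {y. \<forall>k\<in>K. (k, y) \<in> S}" using J UV by blast
  ultimately show "\<exists>T. open T \<and> y \<in> T \<and> T \<subseteq> {y. \<forall>k\<in>K. (k, y) \<in> S}" by blast
qed

lemma right_translate_eq: "(\<lambda>x. x + g) ` U = (\<lambda>x. x - g) -` (U :: 'g::group_add set)"
proof (intro set_eqI iffI)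
  fix x assume "x \<in> (\<lambda>x. x - g) -` U"
  then show "x \<in> (\<lambda>x. x + g) ` U" by (intro image_eqI[of _ _ "x - g"]) auto
qed auto

lemma left_translate_eq: "(+) g ` U = (\<lambda>x. - g + x) -` (U :: 'g::group_add set)"
proof (intro set_eqI iffI)
  fix x assume "x \<in> (\<lambda>x. - g + x) -` U"
  then show "x \<in> (+) g ` U" by (intro image_eqI[of _ _ "- g + x"]) (auto simp flip: add.assoc)
qed (auto simp flip: add.assoc)

lemma open_left_translate:
  assumes "open (U :: 'g::topological_group_add set)" shows "open ((+) g ` U)"
  using assms unfolding left_translate_eq by (intro open_vimage) (auto intro!: continuous_intros)

lemma open_right_translate:
  assumes "open (U :: 'g::topological_group_add set)" shows "open ((\<lambda>x. x + g) ` U)"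
  using assms unfolding right_translate_eq by (intro open_vimage) (auto intro!: continuous_intros)

lemma compact_set_plus:
  fixes K L :: "'g::topological_group_add set"
  assumes "compact K" "compact L" shows "compact (K + L)"
proof -
  have "K + L = (\<lambda>z. fst z + snd z) ` (K \<times> L)" by (auto simp: set_plus_def image_def)
  then show ?thesis
    using assms by (auto intro!: compact_continuous_image compact_Times continuous_intros)
qed

lemma closed_set_plus:
  fixes K B :: "'g::topological_group_add set"
  assumes K: "compact K" and B: "closed B" shows "closed (K + B)"
proof -
  have "- (K + B) = {x. \<forall>k\<in>K. (k, x) \<in> (\<lambda>z. - fst z + snd z) -` (- B)}"
  proof (intro set_eqI iffI)
    fix x assume "x \<in> - (K + B)"
    moreover have "x = k + (- k + x)" for k by (simp flip: add.assoc)
    ultimately have "- k + x \<notin> B" if "k \<in> K" for k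
      using that by (metis ComplD set_plus_intro)
    then show "x \<in> {x. \<forall>k\<in>K. (k, x) \<in> (\<lambda>z. - fst z + snd z) -` (- B)}"
      by simp
  qed (auto simp: set_plus_def add.assoc[symmetric])
  moreover have "open ((\<lambda>z. - fst z + snd z) -` (- B))"
    using B by (intro open_vimage) (auto intro!: continuous_intros)
  then have "open {x. \<forall>k\<in>K. (k, x) \<in> (\<lambda>z. - fst z + snd z) -` (- B)}"
    by (rule open_forall_compact[OF K])
  ultimately have "open (- (K + B))" by simp
  then show ?thesis by (simp add: closed_def)
qed

text \<open>
  Closedness makes boundaries measurable; as \<open>measure \<mu>\<close> vanishes on non-measurable sets, the Van
  Hove condition would otherwise say nothing about them.
\<close>
lemma boundary_closed_compact:
  fixes A :: "'g::{topological_group_add, t2_space} set"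
  assumes "compact K" "compact A"
  shows "closed (boundary K A)" "compact (boundary K A)"
proof -
  show c: "closed (boundary K A)"
    unfolding boundary_def using assms by (intro closed_Int closed_set_plus) auto
  have "boundary K A \<subseteq> K + A"
    using assms by (simp add: boundary_def compact_imp_closed)
  then have "boundary K A = (K + A) \<inter> boundary K A" by blast
  moreover have "compact ((K + A) \<inter> boundary K A)"
    using compact_set_plus[OF assms] c by (rule compact_Int_closed)
  ultimately show "compact (boundary K A)" by simp
qed

context
  fixes \<mu> :: "'g::{topological_group_add, t2_space} measure"
  assumes haar: "haar_measure \<mu>"
begin

lemma haar_sets: "sets \<mu> = sets borel" and haar_space: "space \<mu> = UNIV"
  using haar sets_eq_imp_space_eq[of \<mu> borel]
  by (auto simp: haar_measure_def regular_borel_measure_def)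

lemma haar_compact_finite: "compact K \<Longrightarrow> emeasure \<mu> K < \<infinity>"
  using haar by (simp add: haar_measure_def regular_borel_measure_def)

lemma haar_left: "B \<in> sets borel \<Longrightarrow> emeasure \<mu> ((+) g ` B) = emeasure \<mu> B"
  and haar_right: "B \<in> sets borel \<Longrightarrow> emeasure \<mu> ((\<lambda>x. x + g) ` B) = emeasure \<mu> B"
  using haar by (auto simp: haar_measure_def)

text \<open>
  If an open set were null, then so would be every compact set, being covered by finitely many of
  its translates, and by inner regularity the whole group.
\<close>
lemma haar_open_pos:
  assumes U: "open U" "U \<noteq> {}" shows "0 < emeasure \<mu> U"
proof (rule ccontr)
  assume "\<not> 0 < emeasure \<mu> U"
  then have U0: "emeasure \<mu> U = 0" by simp
  obtain u where u: "u \<in> U" using U by blast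
  have K0: "emeasure \<mu> K = 0" if K: "compact K" for K
  proof -
    let ?V = "\<lambda>k. (+) (k - u) ` U"
    have "K \<subseteq> (\<Union>k\<in>K. ?V k)"
    proof
      fix k assume "k \<in> K"
      moreover have "k \<in> ?V k" using u by (intro image_eqI[of _ _ u]) auto
      ultimately show "k \<in> (\<Union>k\<in>K. ?V k)" by blast
    qed
    then obtain J where J: "J \<subseteq> K" "finite J" "K \<subseteq> (\<Union>k\<in>J. ?V k)"
      using compactE_image[OF K, of K ?V] open_left_translate[OF U(1)] by metis
    have meas: "?V k \<in> sets \<mu>" for k
      using open_left_translate[OF U(1)] by (simp add: haar_sets)
    have "emeasure \<mu> K \<le> emeasure \<mu> (\<Union>k\<in>J. ?V k)"
      using J meas by (intro emeasure_mono) auto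
    also have "\<dots> \<le> (\<Sum>k\<in>J. emeasure \<mu> (?V k))"
      using J meas by (intro emeasure_subadditive_finite) auto
    also have "\<dots> = 0" using U U0 by (simp add: haar_left)
    finally show ?thesis by simp
  qed
  have "emeasure \<mu> UNIV = (SUP K\<in>{K. compact K \<and> K \<subseteq> UNIV}. emeasure \<mu> K)"
    using haar unfolding haar_measure_def regular_borel_measure_def by blast
  also have "\<dots> = 0"
    using K0 by (intro antisym SUP_least) (auto simp del: le_zero_eq simp: le_zero_eq[symmetric])
  finally show False using haar haar_space by (simp add: haar_measure_def)
qed

text \<open>
  Since \<open>measure\<close> is \<open>0\<close> on sets of infinite measure, monotonicity needs the bounding compact set.
\<close>
lemma haar_measure_mono:
  assumes "B \<in> sets borel" "compact K" "A \<subseteq> B" "B \<subseteq> K"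
  shows "measure \<mu> A \<le> measure \<mu> B"
proof -
  have "emeasure \<mu> B \<le> emeasure \<mu> K"
    using assms by (intro emeasure_mono) (auto simp: haar_sets compact_imp_closed)
  then have "emeasure \<mu> B \<noteq> \<infinity>" using haar_compact_finite[OF assms(2)] by auto
  then show ?thesis
    using assms unfolding measure_def by (intro enn2real_mono emeasure_mono) (auto simp: haar_sets less_top)
qed

end

lemma discrete_subgroup_separating_open:
  fixes \<Lambda> :: "'g::{topological_group_add, t2_space} set"
  assumes "add_subgroup \<Lambda>" "discrete \<Lambda>"
  obtains V where "open V" "0 \<in> V" "\<And>v w. v \<in> V \<Longrightarrow> w \<in> V \<Longrightarrow> - v + w \<in> \<Lambda> \<Longrightarrow> v = w"
proof -
  have "0 \<in> \<Lambda>" using assms by (simp add: add_subgroup_def)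
  then obtain U where U: "open U" "U \<inter> \<Lambda> = {0}"
    using assms by (auto simp: discrete_def isolated_in_def)
  define S where "S = (\<lambda>z. - fst z + snd z) -` U"
  have S: "open S" unfolding S_def using U by (intro open_vimage) (auto intro!: continuous_intros)
  have "(0, 0) \<in> S" using U by (auto simp: S_def)
  then obtain A B where "open A" "open B" and 0: "(0, 0) \<in> A \<times> B" and "A \<times> B \<subseteq> S"
    using open_prod_elim[OF S] by metis
  then have AB: "open A" "open B" "0 \<in> A" "0 \<in> B" "A \<times> B \<subseteq> S" by (simp_all only: mem_Times_iff fst_conv snd_conv)
  show thesis
  proof (rule that[of "A \<inter> B"])
    fix v w assume "v \<in> A \<inter> B" "w \<in> A \<inter> B" "- v + w \<in> \<Lambda>"
    then have "- v + w \<in> U \<inter> \<Lambda>" using AB by (auto simp: S_def)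
    then have "- v + w = 0" using U by auto
    then show "v = w" by (metis add.right_neutral add_minus_cancel)
  qed (use AB in auto)
qed

text \<open>
  Let \<open>V\<close> be a relatively compact open neighbourhood of \<open>0\<close> such that the quotient map is injective on
  each \<open>g + V\<close>. By compactness of the quotient, finitely many translates \<open>g\<^sub>0 + V, \<dots>, g\<^sub>n + V\<close> meet
  all cosets. Remove from \<open>g\<^sub>j + V\<close> the cosets that are met by an earlier translate: what is left of
  all translates together meets each coset exactly once. Saturations of open sets are open, so every
  piece is a difference of open sets, and the first piece is open.
\<close>
theorem uniform_lattice_fundamental_domain:
  fixes \<Lambda> :: "'g::{topological_group_add, t2_space} set"
  assumes lc: "locally_compact_space (euclidean :: 'g topology)" and lat: "uniform_lattice \<Lambda>"
  obtains D C where "D \<in> sets borel" "D \<subseteq> C" "compact C" "interior D \<noteq> {}"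
    "\<And>x. \<exists>!s. s \<in> \<Lambda> \<and> x - s \<in> D"
proof -
  have sub: "add_subgroup \<Lambda>" and disc: "discrete \<Lambda>"
    and cpt: "compact_space (left_coset_topology \<Lambda>)"
    using lat by (auto simp: uniform_lattice_def)
  note grp = sub[unfolded add_subgroup_def]
  obtain V0 where V0: "open V0" "0 \<in> V0" "\<And>v w. v \<in> V0 \<Longrightarrow> w \<in> V0 \<Longrightarrow> - v + w \<in> \<Lambda> \<Longrightarrow> v = w"
    using discrete_subgroup_separating_open[OF sub disc] by blast
  obtain V1 K :: "'g set" where V1: "open V1" "compact K" "0 \<in> V1" "V1 \<subseteq> K"
  proof -
    have "\<exists>U K. open U \<and> compact K \<and> (0::'g) \<in> U \<and> U \<subseteq> K"
      using lc by (simp add: locally_compact_space_def)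
    then show thesis using that by blast
  qed
  define V where "V = V0 \<inter> V1"
  have V: "open V" "0 \<in> V" "V \<subseteq> K" using V0(1,2) V1 by (auto simp: V_def)
  define gV where "gV g = (+) g ` V" for g
  have gV_sep: "x = y" if x: "x \<in> gV g" and y: "y \<in> gV g" and l: "- x + y \<in> \<Lambda>" for x y g
  proof -
    obtain v w where vw: "x = g + v" "y = g + w" "v \<in> V0" "w \<in> V0" using x y by (auto simp: gV_def V_def)
    have "- x + y = - v + w" by (simp add: vw minus_add add.assoc del: add_uminus_conv_diff)
    then have "v = w" using V0(3)[of v w] vw l by simp
    then show ?thesis by (simp add: vw)
  qed
  define coset where "coset g = g +o \<Lambda>" for g :: 'g
  have coset_eq: "coset g = coset h \<longleftrightarrow> - g + h \<in> \<Lambda>" for g h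
  proof
    assume "coset g = coset h"
    moreover have "h \<in> coset h" using grp by (auto simp: coset_def elt_set_plus_def intro: bexI[of _ 0])
    ultimately obtain l where "l \<in> \<Lambda>" "h = g + l" by (auto simp: coset_def elt_set_plus_def)
    then show "- g + h \<in> \<Lambda>" by (simp flip: add.assoc)
  next
    assume l: "- g + h \<in> \<Lambda>"
    then have l': "- h + g \<in> \<Lambda>" using grp by (metis minus_add minus_minus)
    show "coset g = coset h"
    proof (intro set_eqI iffI)
      fix x assume "x \<in> coset g"
      then obtain m where m: "m \<in> \<Lambda>" "x = g + m" by (auto simp: coset_def elt_set_plus_def)
      have "x = h + ((- h + g) + m)" by (simp add: m flip: add.assoc)
      then show "x \<in> coset h" using grp l' m by (auto simp: coset_def elt_set_plus_def)
    next
      fix x assume "x \<in> coset h"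
      then obtain m where m: "m \<in> \<Lambda>" "x = h + m" by (auto simp: coset_def elt_set_plus_def)
      have "x = g + ((- g + h) + m)" by (simp add: m flip: add.assoc)
      then show "x \<in> coset g" using grp l m by (auto simp: coset_def elt_set_plus_def)
    qed
  qed
  have open_sat: "open {x. coset x \<in> coset ` U}" if "open U" for U
  proof -
    have "{x. coset x \<in> coset ` U} = (\<Union>l\<in>\<Lambda>. (\<lambda>x. x + l) ` U)"
    proof (intro set_eqI iffI)
      fix x assume "x \<in> {x. coset x \<in> coset ` U}"
      then obtain u where u: "u \<in> U" "coset u = coset x" by auto
      then have "- u + x \<in> \<Lambda>" using coset_eq by blast
      moreover have "x = u + (- u + x)" by (simp flip: add.assoc)
      ultimately show "x \<in> (\<Union>l\<in>\<Lambda>. (\<lambda>x. x + l) ` U)" using u by blast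
    next
      fix x assume "x \<in> (\<Union>l\<in>\<Lambda>. (\<lambda>x. x + l) ` U)"
      then obtain l u where "l \<in> \<Lambda>" "u \<in> U" "x = u + l" by blast
      moreover have "coset u = coset (u + l)" using \<open>l \<in> \<Lambda>\<close> coset_eq by (simp flip: add.assoc)
      ultimately show "x \<in> {x. coset x \<in> coset ` U}" by auto
    qed
    then show ?thesis using open_right_translate[OF that] by auto
  qed
  have topsp: "topspace (left_coset_topology \<Lambda>) = range coset"
    using quotient_imp_surjective_map[OF quotient_map_left_coset_topology[of \<Lambda>]]
    by (simp add: coset_def[abs_def])
  obtain \<F> where \<F>: "finite \<F>" "\<F> \<subseteq> range (\<lambda>g. coset ` gV g)" "range coset \<subseteq> \<Union>\<F>"
  proof -
    have "openin (left_coset_topology \<Lambda>) U" if U: "U \<in> range (\<lambda>g. coset ` gV g)" for U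
    proof -
      obtain g where g: "U = coset ` gV g" using U by blast
      have "open (gV g)" unfolding gV_def using V by (intro open_left_translate)
      from open_sat[OF this] show ?thesis
        by (auto simp: openin_left_coset_topology g coset_def)
    qed
    moreover have "topspace (left_coset_topology \<Lambda>) \<subseteq> \<Union>(range (\<lambda>g. coset ` gV g))"
    proof -
      have "coset g \<in> coset ` gV g" for g
      proof (rule imageI)
        show "g \<in> gV g" unfolding gV_def using V(2) by (intro image_eqI[of _ _ 0]) simp_all
      qed
      then show ?thesis
        unfolding topsp by (intro image_subsetI) (rule UnionI[OF rangeI])
    qed
    ultimately have "\<exists>\<F>. finite \<F> \<and> \<F> \<subseteq> range (\<lambda>g. coset ` gV g) \<and> topspace (left_coset_topology \<Lambda>) \<subseteq> \<Union>\<F>"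
      by (intro cpt[unfolded compact_space_alt, THEN spec, THEN mp] conjI ballI)
    then show thesis unfolding topsp by (elim exE conjE) (rule that)
  qed
  obtain J where J: "finite J" "\<F> = (\<lambda>g. coset ` gV g) ` J"
    using finite_subset_image[OF \<F>(1,2)] by blast
  obtain gs where gs: "J = set gs" using finite_list[OF J(1)] by blast
  define n where "n = length gs"
  have cover: "\<exists>j<n. coset x \<in> coset ` gV (gs ! j)" for x
  proof -
    have "coset x \<in> \<Union>\<F>" using \<F> by blast
    then obtain g where "g \<in> set gs" "coset x \<in> coset ` gV g" using J gs by auto
    then show ?thesis by (auto simp: in_set_conv_nth n_def)
  qed
  define piece where "piece j = gV (gs ! j) - (\<Union>k<j. {x. coset x \<in> coset ` gV (gs ! k)})" for j
  define D where "D = (\<Union>j<n. piece j)"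
  have op: "open (gV g)" for g unfolding gV_def using V by (intro open_left_translate)
  have n0: "0 < n" using cover[of 0] by auto
  show thesis
  proof (rule that)
    show "D \<in> sets borel" unfolding D_def piece_def using op open_sat[OF op] by (intro sets.finite_UN sets.Diff) auto
    show "D \<subseteq> (\<Union>j<n. (+) (gs ! j) ` K)" using V by (auto simp: D_def piece_def gV_def)
    show "compact (\<Union>j<n. (+) (gs ! j) ` K)"
      using V1 by (intro compact_UN compact_continuous_image) (auto intro!: continuous_intros)
    have "gV (gs ! 0) \<subseteq> D" using n0 by (auto simp: D_def piece_def)
    then have "gV (gs ! 0) \<subseteq> interior D" using op by (rule interior_maximal)
    moreover have "gs ! 0 \<in> gV (gs ! 0)"
      unfolding gV_def using V(2) by (intro image_eqI[of _ _ 0]) simp_all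
    ultimately show "interior D \<noteq> {}" by blast
  next
    fix x
    \<comment> \<open>The representative of the coset of \<open>x\<close> lies in the first translate that the coset meets.\<close>
    define j where "j = (LEAST j. coset x \<in> coset ` gV (gs ! j))"
    have j: "coset x \<in> coset ` gV (gs ! j)"
      unfolding j_def using cover[of x] by (metis (mono_tags, lifting) LeastI)
    have jn: "j < n" using cover[of x] unfolding j_def by (meson Least_le le_less_trans)
    obtain y where y: "y \<in> gV (gs ! j)" "coset y = coset x" using j by auto
    have "k < j \<Longrightarrow> coset y \<notin> coset ` gV (gs ! k)" for k
      using not_less_Least[of k] y by (simp add: j_def)
    then have yD: "y \<in> D" using y jn by (auto simp: D_def piece_def)
    have lat_y: "- y + x \<in> \<Lambda>" using y coset_eq by blast
    have "x - (- y + x) = y" by (simp add: diff_conv_add_uminus minus_add del: add_uminus_conv_diff flip: add.assoc)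
    with yD lat_y have ex: "- y + x \<in> \<Lambda> \<and> x - (- y + x) \<in> D" by simp
    show "\<exists>!s. s \<in> \<Lambda> \<and> x - s \<in> D"
    proof (rule ex1I[of _ "- y + x"])
      show "- y + x \<in> \<Lambda> \<and> x - (- y + x) \<in> D" by (rule ex)
    next
      fix l assume l: "l \<in> \<Lambda> \<and> x - l \<in> D"
      define z where "z = x - l"
      have zx: "- z + x = l" by (simp add: z_def)
      then have cz: "coset z = coset x" using l coset_eq by simp
      obtain i where i: "i < n" "z \<in> piece i" using l by (auto simp: z_def D_def)
      have "coset x \<in> coset ` gV (gs ! i)" using i cz by (auto simp: piece_def)
      then have "j \<le> i" unfolding j_def by (rule Least_le)
      moreover have "\<not> j < i" using i j cz by (auto simp: piece_def)
      ultimately have "z \<in> gV (gs ! j)" using i by (auto simp: piece_def)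
      moreover have "- y + z \<in> \<Lambda>" using cz y coset_eq by metis
      ultimately have "y = z" using gV_sep y by blast
      then show "l = - y + x" using zx by simp
    qed
  qed
qed

section \<open>Passing from Van Hove nets to the lattice\<close>

definition compact_subadditive :: "('g::{topological_group_add, t2_space} set \<Rightarrow> real) \<Rightarrow> bool" where
  "compact_subadditive f \<longleftrightarrow>
     f {} = 0 \<and>
     (\<forall>A B. compact A \<longrightarrow> compact B \<longrightarrow> A \<subseteq> B \<longrightarrow> f A \<le> f B) \<and>
     (\<forall>A B. compact A \<longrightarrow> compact B \<longrightarrow> f (A \<union> B) \<le> f A + f B) \<and>
     (\<forall>A g. compact A \<longrightarrow> f ((\<lambda>x. x + g) ` A) = f A)"

lemma compact_subadditiveD:
  assumes "compact_subadditive f"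
  shows "f {} = 0"
    and "compact A \<Longrightarrow> compact B \<Longrightarrow> A \<subseteq> B \<Longrightarrow> f A \<le> f B"
    and "compact A \<Longrightarrow> compact B \<Longrightarrow> f (A \<union> B) \<le> f A + f B"
    and "compact A \<Longrightarrow> f ((\<lambda>x. x + g) ` A) = f A"
  using assms unfolding compact_subadditive_def by simp_all

lemma set_plus_Un_right: "C + (F \<union> G) = (C + F) \<union> (C + (G :: 'a::plus set))"
  by (auto simp: set_plus_def)

lemma set_plus_right_translate:
  "C + (\<lambda>x. x + c) ` F = (\<lambda>x. x + c) ` (C + (F :: 'a::semigroup_add set))"
proof (intro set_eqI iffI)
  fix y assume "y \<in> C + (\<lambda>x. x + c) ` F"
  then obtain a b where "a \<in> C" "b \<in> F" "y = a + (b + c)" by (auto simp: set_plus_def)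
  then show "y \<in> (\<lambda>x. x + c) ` (C + F)"
    by (intro image_eqI[of _ _ "a + b"]) (auto simp: add.assoc)
next
  fix y assume "y \<in> (\<lambda>x. x + c) ` (C + F)"
  then obtain a b where "a \<in> C" "b \<in> F" "y = (a + b) + c" by (auto simp: set_plus_def)
  then show "y \<in> C + (\<lambda>x. x + c) ` F" by (auto simp: add.assoc)
qed

lemma set_plus_empty [simp]: "C + {} = ({} :: 'a::plus set)" "{} + C = {}"
  by (auto simp: set_plus_def)

lemma compact_subadditive_imp_subadditive_invariant:
  assumes f: "compact_subadditive f" and C: "compact C"
  shows "subadditive_invariant H (\<lambda>F. f (C + F))"
proof -
  have cF: "compact (C + F)" if "finite F" for F
    using C that by (simp add: compact_set_plus finite_imp_compact)
  have nonneg: "0 \<le> f B" if "compact B" for B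
  proof -
    have "f {} \<le> f B" using that by (intro compact_subadditiveD(2)[OF f]) auto
    then show ?thesis by (simp add: compact_subadditiveD(1)[OF f])
  qed
  show ?thesis
    unfolding subadditive_invariant_def set_plus_right_translate set_plus_Un_right
    using f cF nonneg by (simp add: compact_subadditive_def)
qed

text \<open>
  The last assumption says that the sets \<open>D + s\<close> with \<open>s \<in> \<Lambda>\<close> partition the group. The compact set \<open>C\<close>
  serves to turn finite subsets \<open>F\<close> of \<open>\<Lambda>\<close> into compact sets \<open>C + F\<close>.
\<close>
locale lattice_domain =
  fixes \<mu> :: "'g::{topological_group_add, t2_space} measure" and \<Lambda> D C :: "'g set"
  assumes haar: "haar_measure \<mu>"
    and subgroup: "add_subgroup \<Lambda>"
    and D_borel: "D \<in> sets borel"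
    and D_subset: "D \<subseteq> C"
    and C_compact: "compact C"
    and D_interior: "interior D \<noteq> {}"
    and D_unique: "\<And>x. \<exists>!s. s \<in> \<Lambda> \<and> x - s \<in> D"
begin

text \<open>The finite subset of the lattice that represents \<open>A\<close>.\<close>
definition hit :: "'g set \<Rightarrow> 'g set" where
  "hit A = {s\<in>\<Lambda>. (\<lambda>x. x + s) ` C \<inter> A \<noteq> {}}"

definition C_minus_C :: "'g set" where "C_minus_C = C + uminus ` C"

lemma compact_C_minus_C: "compact C_minus_C"
  unfolding C_minus_C_def using C_compact
  by (intro compact_set_plus compact_continuous_image) (auto intro!: continuous_intros)

lemma emeasure_finite_of_subset_compact:
  assumes "B \<subseteq> K" "compact K"
  shows "emeasure \<mu> B \<noteq> \<infinity>"
proof -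
  have "emeasure \<mu> B \<le> emeasure \<mu> K"
    using assms by (intro emeasure_mono) (auto simp: haar_sets[OF haar] compact_imp_closed)
  then show ?thesis using haar_compact_finite[OF haar assms(2)] by auto
qed

lemma measure_D_pos: "0 < measure \<mu> D"
proof -
  have "0 < emeasure \<mu> (interior D)" using haar_open_pos[OF haar] D_interior by simp
  also have "\<dots> \<le> emeasure \<mu> D"
    using D_borel interior_subset by (intro emeasure_mono) (auto simp: haar_sets[OF haar])
  finally have "0 < emeasure \<mu> D" .
  moreover have "emeasure \<mu> D \<noteq> \<infinity>"
    using D_subset C_compact by (rule emeasure_finite_of_subset_compact)
  ultimately show ?thesis by (simp add: measure_def enn2real_positive_iff top.not_eq_extremum)
qed

lemma D_translate:
  "(\<lambda>x. x + s) ` D \<in> sets \<mu>" "measure \<mu> ((\<lambda>x. x + s) ` D) = measure \<mu> D"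
  "emeasure \<mu> ((\<lambda>x. x + s) ` D) \<noteq> \<infinity>"
proof -
  have "(\<lambda>x. x + s) ` D = (\<lambda>x. x - s) -` D" by (rule right_translate_eq)
  also have "\<dots> = (\<lambda>x. x - s) -` D \<inter> space borel" by simp
  also have "\<dots> \<in> sets borel"
  proof (rule measurable_sets[OF _ D_borel])
    have "continuous_on UNIV (\<lambda>x. x - s)" by (intro continuous_intros)
    then show "(\<lambda>x. x - s) \<in> borel_measurable borel" by (rule borel_measurable_continuous_onI)
  qed
  finally show "(\<lambda>x. x + s) ` D \<in> sets \<mu>" by (simp add: haar_sets[OF haar])
  have eq: "emeasure \<mu> ((\<lambda>x. x + s) ` D) = emeasure \<mu> D" using haar_right[OF haar D_borel] .
  then show "measure \<mu> ((\<lambda>x. x + s) ` D) = measure \<mu> D" by (simp add: measure_def)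
  show "emeasure \<mu> ((\<lambda>x. x + s) ` D) \<noteq> \<infinity>"
    using eq emeasure_finite_of_subset_compact[OF D_subset C_compact] by simp
qed

lemma disjoint_translates: "disjoint_family_on (\<lambda>s. (\<lambda>x. x + s) ` D) \<Lambda>"
proof (unfold disjoint_family_on_def, intro ballI impI)
  fix s t assume st: "s \<in> \<Lambda>" "t \<in> \<Lambda>" "s \<noteq> t"
  show "(\<lambda>x. x + s) ` D \<inter> (\<lambda>x. x + t) ` D = {}"
    using D_unique st unfolding right_translate_eq by blast
qed

text \<open>
  Disjoint translates of \<open>D\<close> fit into \<open>B\<close> at most \<open>\<mu>(B) / \<mu>(D)\<close> times. This converts measures of
  boundaries into cardinalities in the lattice, and is also the reason why the sets involved are
  finite.
\<close>
lemma packing_bound: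
  assumes P: "P \<subseteq> \<Lambda>" and B: "compact B" and sub: "\<And>s. s \<in> P \<Longrightarrow> (\<lambda>x. x + s) ` D \<subseteq> B"
  shows "finite P" "real (card P) * measure \<mu> D \<le> measure \<mu> B"
proof -
  have *: "real (card Q) * measure \<mu> D \<le> measure \<mu> B" if Q: "Q \<subseteq> P" "finite Q" for Q
  proof -
    have "real (card Q) * measure \<mu> D = (\<Sum>s\<in>Q. measure \<mu> ((\<lambda>x. x + s) ` D))"
      by (simp add: D_translate)
    also have "\<dots> = measure \<mu> (\<Union>s\<in>Q. (\<lambda>x. x + s) ` D)"
      using disjoint_family_on_mono[OF _ disjoint_translates, of Q] Q P D_translate
      by (intro measure_finite_Union[symmetric]) auto
    also have "\<dots> \<le> measure \<mu> B"
    proof (rule haar_measure_mono[OF haar _ B _ subset_refl])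
      show "B \<in> sets borel" using B by (simp add: compact_imp_closed)
      show "(\<Union>s\<in>Q. (\<lambda>x. x + s) ` D) \<subseteq> B" using Q sub by (intro UN_least) blast
    qed
    finally show ?thesis .
  qed
  show "finite P"
  proof (rule ccontr)
    assume inf: "infinite P"
    define n where "n = Suc (nat \<lceil>measure \<mu> B / measure \<mu> D\<rceil>)"
    obtain Q where Q: "Q \<subseteq> P" "finite Q" "card Q = n"
      using infinite_arbitrarily_large[OF inf, of n] by blast
    have "real n * measure \<mu> D \<le> measure \<mu> B" using *[OF Q(1,2)] Q by simp
    then have "real n \<le> measure \<mu> B / measure \<mu> D" using measure_D_pos by (simp add: pos_le_divide_eq)
    then show False unfolding n_def by linarith
  qed
  then show "real (card P) * measure \<mu> D \<le> measure \<mu> B" by (intro *) auto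
qed

lemma hit_near:
  assumes "(\<lambda>x. x + s) ` C \<inter> B \<noteq> {}"
  shows "(\<lambda>x. x + s) ` C \<subseteq> C_minus_C + B"
proof
  fix y assume "y \<in> (\<lambda>x. x + s) ` C"
  then obtain c where c: "c \<in> C" "y = c + s" by auto
  obtain d where d: "d \<in> C" "d + s \<in> B" using assms by auto
  have "y = (c + - d) + (d + s)" by (simp add: c add.assoc del: add_uminus_conv_diff)
  then show "y \<in> C_minus_C + B" using c d unfolding C_minus_C_def by (metis imageI set_plus_intro)
qed

lemma finite_hit: assumes "compact A" shows "finite (hit A)"
proof (rule packing_bound)
  show "compact (C_minus_C + A)" using compact_C_minus_C assms by (rule compact_set_plus)
  show "(\<lambda>x. x + s) ` D \<subseteq> C_minus_C + A" if "s \<in> hit A" for s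
    using hit_near[of s A] that D_subset by (auto simp: hit_def)
qed (auto simp: hit_def)

lemma hit_cover: "A \<subseteq> C + hit A"
proof
  fix x assume x: "x \<in> A"
  obtain s where s: "s \<in> \<Lambda>" "x - s \<in> D" using D_unique[of x] by blast
  have eq: "x = (x - s) + s" by simp
  have "s \<in> hit A" using s x D_subset by (force simp: hit_def)
  then show "x \<in> C + hit A" using s D_subset eq by (metis set_plus_intro subsetD)
qed

lemma measure_le_card_hit:
  assumes A: "compact A"
  shows "measure \<mu> A \<le> real (card (hit A)) * measure \<mu> D"
proof -
  have cover: "A \<subseteq> (\<Union>s\<in>hit A. (\<lambda>x. x + s) ` D)"
  proof
    fix x assume x: "x \<in> A"
    obtain s where s: "s \<in> \<Lambda>" "x - s \<in> D" using D_unique[of x] by blast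
    have "s \<in> hit A" using s x D_subset by (force simp: hit_def)
    then show "x \<in> (\<Union>s\<in>hit A. (\<lambda>x. x + s) ` D)" using s by (force simp: right_translate_eq)
  qed
  have "measure \<mu> A \<le> measure \<mu> (\<Union>s\<in>hit A. (\<lambda>x. x + s) ` D)"
  proof (rule haar_measure_mono[OF haar _ _ cover])
    show "(\<Union>s\<in>hit A. (\<lambda>x. x + s) ` D) \<in> sets borel"
      using D_translate(1) finite_hit[OF A] by (auto simp: haar_sets[OF haar])
    show "compact (C_minus_C + A)" using compact_C_minus_C A by (rule compact_set_plus)
    show "(\<Union>s\<in>hit A. (\<lambda>x. x + s) ` D) \<subseteq> C_minus_C + A"
      using hit_near[of _ A] D_subset by (fastforce simp: hit_def)
  qed
  also have "\<dots> \<le> (\<Sum>s\<in>hit A. measure \<mu> ((\<lambda>x. x + s) ` D))"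
    using D_translate finite_hit[OF A] by (intro measure_subadditive_finite) auto
  also have "\<dots> = real (card (hit A)) * measure \<mu> D" by (simp add: D_translate)
  finally show ?thesis .
qed

definition fringe :: "'g set \<Rightarrow> 'g set" where
  "fringe A = {s\<in>hit A. \<not> (\<lambda>x. x + s) ` C \<subseteq> A}"

text \<open>
  Within a translate \<open>C + s\<close> that meets both \<open>A\<close> and its complement, each point differs from a point
  of either set by an element of \<open>C - C\<close>, so the translate lies in the boundary.
\<close>
lemma card_fringe:
  assumes A: "compact A"
  shows "real (card (fringe A)) * measure \<mu> D \<le> measure \<mu> (boundary C_minus_C A)"
proof (rule packing_bound)
  show "compact (boundary C_minus_C A)" using boundary_closed_compact(2)[OF compact_C_minus_C A] .
  show "fringe A \<subseteq> \<Lambda>" by (auto simp: fringe_def hit_def)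
  fix s assume s: "s \<in> fringe A"
  have "(\<lambda>x. x + s) ` C \<subseteq> C_minus_C + A" using s by (intro hit_near) (auto simp: fringe_def hit_def)
  also have "\<dots> \<subseteq> C_minus_C + closure A" by (intro set_plus_mono2 closure_subset) auto
  finally have 1: "(\<lambda>x. x + s) ` C \<subseteq> C_minus_C + closure A" .
  have "(\<lambda>x. x + s) ` C \<subseteq> C_minus_C + (- A)" using s by (intro hit_near) (auto simp: fringe_def)
  also have "\<dots> \<subseteq> C_minus_C + closure (- A)" by (intro set_plus_mono2 closure_subset) auto
  finally have 2: "(\<lambda>x. x + s) ` C \<subseteq> C_minus_C + closure (- A)" .
  show "(\<lambda>x. x + s) ` D \<subseteq> boundary C_minus_C A"
    unfolding boundary_def
      by (intro Int_greatest order_trans[OF image_mono[OF D_subset] 1]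
          order_trans[OF image_mono[OF D_subset] 2])
qed

definition C_minus_shift_C :: "'g \<Rightarrow> 'g set" where
  "C_minus_shift_C t = C_minus_C \<union> (C + (+) (- t) ` uminus ` C)"

lemma compact_C_minus_shift_C: "compact (C_minus_shift_C t)"
  unfolding C_minus_shift_C_def using C_compact compact_C_minus_C
  by (intro compact_Un compact_set_plus compact_continuous_image) (auto intro!: continuous_intros)

text \<open>
  If \<open>C + s\<close> meets \<open>A\<close> but \<open>C + t + s\<close> does not, then a point \<open>c + s\<close> differs from the point
  \<open>c + t + s\<close> of the complement by \<open>c - t - c\<close>; hence \<open>C + s\<close> lies in the boundary of \<open>A\<close> with
  respect to \<open>(C - C) \<union> (C - t - C)\<close>.
\<close>
lemma hit_shift_defect:
  assumes A: "compact A" and t: "t \<in> \<Lambda>"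
  shows "real (card ((+) t ` hit A - hit A)) * measure \<mu> D \<le> measure \<mu> (boundary (C_minus_shift_C t) A)"
proof -
  define P where "P = {s\<in>hit A. t + s \<notin> hit A}"
  have "(+) t ` hit A - hit A = (+) t ` P" by (auto simp: P_def)
  then have "card ((+) t ` hit A - hit A) = card P" by (simp add: card_image)
  moreover have "real (card P) * measure \<mu> D \<le> measure \<mu> (boundary (C_minus_shift_C t) A)"
  proof (rule packing_bound)
    show "compact (boundary (C_minus_shift_C t) A)"
      using boundary_closed_compact(2)[OF compact_C_minus_shift_C A] .
    show "P \<subseteq> \<Lambda>" by (auto simp: P_def hit_def)
    fix s assume s: "s \<in> P"
    then have sL: "t + s \<in> \<Lambda>" using t subgroup by (auto simp: P_def hit_def add_subgroup_def)
    have "(\<lambda>x. x + s) ` C \<subseteq> C_minus_C + A" using s by (intro hit_near) (auto simp: P_def hit_def)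
    also have "\<dots> \<subseteq> C_minus_shift_C t + closure A"
      by (intro set_plus_mono2 closure_subset) (auto simp: C_minus_shift_C_def)
    finally have 1: "(\<lambda>x. x + s) ` C \<subseteq> C_minus_shift_C t + closure A" .
    have 2: "(\<lambda>x. x + s) ` C \<subseteq> C_minus_shift_C t + closure (- A)"
    proof
      fix y assume "y \<in> (\<lambda>x. x + s) ` C"
      then obtain c where c: "c \<in> C" "y = c + s" by auto
      have "c + (t + s) \<notin> A" using s sL c by (auto simp: P_def hit_def)
      then have "c + (t + s) \<in> closure (- A)" using closure_subset by blast
      moreover have "c + (- t + - c) \<in> C_minus_shift_C t"
        unfolding C_minus_shift_C_def using c by (intro UnI2 set_plus_intro imageI)
      moreover have "y = (c + (- t + - c)) + (c + (t + s))"
        by (simp add: c add.assoc del: add_uminus_conv_diff)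
      ultimately show "y \<in> C_minus_shift_C t + closure (- A)" by (metis set_plus_intro)
    qed
    show "(\<lambda>x. x + s) ` D \<subseteq> boundary (C_minus_shift_C t) A"
      unfolding boundary_def
      by (intro Int_greatest order_trans[OF image_mono[OF D_subset] 1]
          order_trans[OF image_mono[OF D_subset] 2])
  qed
  ultimately show ?thesis by simp
qed

context
  fixes A :: "'i::order \<Rightarrow> 'g set"
  assumes vH: "van_hove_net \<mu> A"
begin

lemma net_compact: "compact (A i)" using vH by (simp add: van_hove_net_def)

lemma net_measure_pos: "eventually (\<lambda>i. 0 < measure \<mu> (A i)) at_top"
proof -
  obtain j where j: "\<And>i. j \<le> i \<Longrightarrow> interior (A i) \<noteq> {}" using vH by (auto simp: van_hove_net_def)
  have "eventually (\<lambda>i. j \<le> i) at_top"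
    unfolding at_top_def by (rule eventually_INF1[of j]) (auto simp: eventually_principal)
  then show ?thesis
  proof (rule eventually_mono)
    fix i assume "j \<le> i"
    then have "0 < emeasure \<mu> (interior (A i))" using haar_open_pos[OF haar] j by simp
    also have "\<dots> \<le> emeasure \<mu> (A i)"
      using net_compact interior_subset
      by (intro emeasure_mono) (auto simp: haar_sets[OF haar] compact_imp_closed)
    finally show "0 < measure \<mu> (A i)"
      using emeasure_finite_of_subset_compact[OF subset_refl net_compact]
      by (simp add: measure_def enn2real_positive_iff top.not_eq_extremum)
  qed
qed

lemma net_boundary:
  "compact K \<Longrightarrow> ((\<lambda>i. measure \<mu> (boundary K (A i)) / measure \<mu> (A i)) \<longlongrightarrow> 0) at_top"
  using vH by (simp add: van_hove_net_def)

text \<open>A Van Hove net in the group induces a net of ever more invariant subsets of the lattice.\<close>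
lemma filterlim_hit: "filterlim (\<lambda>i. hit (A i)) (folner \<Lambda>) at_top"
  unfolding filterlim_iff
proof (intro allI impI)
  fix P assume "eventually P (folner \<Lambda>)"
  then obtain T \<delta> where T: "finite T" "T \<subseteq> \<Lambda>" "0 < \<delta>"
    and P: "\<And>F. F \<in> invariant_sets \<Lambda> T \<delta> \<Longrightarrow> P F" unfolding eventually_folner by blast
  have "((\<lambda>i. \<Sum>t\<in>T. measure \<mu> (boundary (C_minus_shift_C t) (A i)) / measure \<mu> (A i)) \<longlongrightarrow> (\<Sum>t\<in>T. 0)) at_top"
    by (intro tendsto_sum net_boundary compact_C_minus_shift_C)
  then have "eventually (\<lambda>i. (\<Sum>t\<in>T. measure \<mu> (boundary (C_minus_shift_C t) (A i)) / measure \<mu> (A i)) < \<delta>) at_top"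
    using T by (intro order_tendstoD(2)) auto
  with net_measure_pos show "eventually (\<lambda>i. P (hit (A i))) at_top"
  proof eventually_elim
    case (elim i)
    let ?F = "hit (A i)"
    have "real (shift_defect T ?F) * measure \<mu> D =
        (\<Sum>t\<in>T. real (card ((+) t ` ?F - ?F)) * measure \<mu> D)"
      by (simp add: shift_defect_def sum_distrib_right)
    also have "\<dots> \<le> (\<Sum>t\<in>T. measure \<mu> (boundary (C_minus_shift_C t) (A i)))"
      using T by (intro sum_mono hit_shift_defect net_compact) auto
    also have "\<dots> = (\<Sum>t\<in>T. measure \<mu> (boundary (C_minus_shift_C t) (A i)) / measure \<mu> (A i)) * measure \<mu> (A i)"
      using elim by (simp add: sum_distrib_right)
    also have "\<dots> \<le> \<delta> * measure \<mu> (A i)" using elim by (intro mult_right_mono) auto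
    also have "\<dots> \<le> \<delta> * (real (card ?F) * measure \<mu> D)"
      using T by (intro mult_left_mono measure_le_card_hit net_compact) auto
    finally have "real (shift_defect T ?F) * measure \<mu> D \<le> (\<delta> * real (card ?F)) * measure \<mu> D"
      by (simp add: mult.assoc)
    then have "real (shift_defect T ?F) \<le> \<delta> * real (card ?F)" using measure_D_pos by simp
    moreover have "?F \<noteq> {}" using measure_le_card_hit[OF net_compact, of i] elim by auto
    moreover have "?F \<subseteq> \<Lambda>" by (auto simp: hit_def)
    ultimately show ?case using P finite_hit[OF net_compact] by (simp add: invariant_sets_def)
  qed
qed

lemma card_hit_asymptotics:
  "((\<lambda>i. real (card (hit (A i))) / measure \<mu> (A i)) \<longlongrightarrow> 1 / measure \<mu> D) at_top"
proof (rule tendsto_sandwich)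
  show "((\<lambda>i. 1 / measure \<mu> D) \<longlongrightarrow> 1 / measure \<mu> D) at_top" by simp
  have "((\<lambda>i. (1 + measure \<mu> (boundary C_minus_C (A i)) / measure \<mu> (A i)) / measure \<mu> D) \<longlongrightarrow> (1 + 0) / measure \<mu> D) at_top"
    using measure_D_pos by (intro tendsto_intros net_boundary compact_C_minus_C) auto
  then show "((\<lambda>i. (1 + measure \<mu> (boundary C_minus_C (A i)) / measure \<mu> (A i)) / measure \<mu> D) \<longlongrightarrow> 1 / measure \<mu> D) at_top"
    by simp
  show "eventually (\<lambda>i. 1 / measure \<mu> D \<le> real (card (hit (A i))) / measure \<mu> (A i)) at_top"
    using net_measure_pos
  proof (rule eventually_mono)
    fix i assume "0 < measure \<mu> (A i)"
    then show "1 / measure \<mu> D \<le> real (card (hit (A i))) / measure \<mu> (A i)"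
      using measure_le_card_hit[OF net_compact, of i] measure_D_pos by (simp add: divide_simps)
  qed
  show "eventually (\<lambda>i. real (card (hit (A i))) / measure \<mu> (A i) \<le>
      (1 + measure \<mu> (boundary C_minus_C (A i)) / measure \<mu> (A i)) / measure \<mu> D) at_top"
    using net_measure_pos
  proof (rule eventually_mono)
    fix i assume pos: "0 < measure \<mu> (A i)"
    let ?I = "hit (A i) - fringe (A i)"
    have "real (card ?I) * measure \<mu> D \<le> measure \<mu> (A i)"
    proof (rule packing_bound(2)[OF _ net_compact])
      show "?I \<subseteq> \<Lambda>" by (auto simp: hit_def)
      show "(\<lambda>x. x + s) ` D \<subseteq> A i" if "s \<in> ?I" for s using that D_subset by (auto simp: fringe_def)
    qed
    moreover have "card (hit (A i)) \<le> card ?I + card (fringe (A i))"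
    proof -
      have "hit (A i) = ?I \<union> fringe (A i)" by (auto simp: fringe_def)
      then show ?thesis by (metis card_Un_le)
    qed
    then have "real (card (hit (A i))) * measure \<mu> D \<le> (real (card ?I) + real (card (fringe (A i)))) * measure \<mu> D"
      using measure_D_pos by (intro mult_right_mono) auto
    ultimately have "real (card (hit (A i))) * measure \<mu> D \<le> measure \<mu> (A i) + measure \<mu> (boundary C_minus_C (A i))"
      using card_fringe[OF net_compact, of i] by (simp add: distrib_right)
    then show "real (card (hit (A i))) / measure \<mu> (A i) \<le>
        (1 + measure \<mu> (boundary C_minus_C (A i)) / measure \<mu> (A i)) / measure \<mu> D"
      using pos measure_D_pos by (simp add: divide_simps)
  qed
qed

text \<open>
  The value \<open>f (A i)\<close> lies between \<open>f (C + hit (A i))\<close> and the same number minus a constant times the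
  cardinality of the fringe, since \<open>C + hit (A i)\<close> is contained in the union of \<open>A i\<close> and the
  translates of \<open>C\<close> by the fringe.
\<close>
theorem van_hove_limit:
  assumes f: "compact_subadditive f"
    and L: "((\<lambda>F. f (C + F) / real (card F)) \<longlongrightarrow> L) (folner \<Lambda>)"
  shows "((\<lambda>i. f (A i) / measure \<mu> (A i)) \<longlongrightarrow> L / measure \<mu> D) at_top"
proof (rule tendsto_sandwich)
  note sub = compact_subadditive_imp_subadditive_invariant[OF f C_compact, of \<Lambda>]
  define M where "M = f (C + {0})"
  have M: "0 \<le> M"
    using subadditive_invariantD(2)[OF sub, of "{0}"] subgroup by (simp add: M_def add_subgroup_def)
  have "((\<lambda>i. (f (C + hit (A i)) / real (card (hit (A i)))) * (real (card (hit (A i))) / measure \<mu> (A i)))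
      \<longlongrightarrow> L * (1 / measure \<mu> D)) at_top"
    by (intro tendsto_mult card_hit_asymptotics filterlim_compose[OF L filterlim_hit])
  moreover have "eventually (\<lambda>i. (f (C + hit (A i)) / real (card (hit (A i)))) * (real (card (hit (A i))) / measure \<mu> (A i))
      = f (C + hit (A i)) / measure \<mu> (A i)) at_top"
    using net_measure_pos
  proof (rule eventually_mono)
    fix i assume "0 < measure \<mu> (A i)"
    then have "0 < real (card (hit (A i))) * measure \<mu> D"
      using measure_le_card_hit[OF net_compact, of i] by linarith
    then have "real (card (hit (A i))) \<noteq> 0" by (simp add: zero_less_mult_iff)
    then show "(f (C + hit (A i)) / real (card (hit (A i)))) * (real (card (hit (A i))) / measure \<mu> (A i))
      = f (C + hit (A i)) / measure \<mu> (A i)" by simp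
  qed
  ultimately have "((\<lambda>i. f (C + hit (A i)) / measure \<mu> (A i)) \<longlongrightarrow> L * (1 / measure \<mu> D)) at_top"
    by (rule Lim_transform_eventually)
  then have upper: "((\<lambda>i. f (C + hit (A i)) / measure \<mu> (A i)) \<longlongrightarrow> L / measure \<mu> D) at_top"
    by simp
  have "((\<lambda>i. f (C + hit (A i)) / measure \<mu> (A i) - M / measure \<mu> D * (measure \<mu> (boundary C_minus_C (A i)) / measure \<mu> (A i)))
      \<longlongrightarrow> L / measure \<mu> D - M / measure \<mu> D * 0) at_top"
    by (intro tendsto_diff tendsto_mult upper net_boundary compact_C_minus_C tendsto_const)
  then show "((\<lambda>i. f (C + hit (A i)) / measure \<mu> (A i) - M / measure \<mu> D * (measure \<mu> (boundary C_minus_C (A i)) / measure \<mu> (A i)))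
      \<longlongrightarrow> L / measure \<mu> D) at_top" by simp
  show "((\<lambda>i. f (C + hit (A i)) / measure \<mu> (A i)) \<longlongrightarrow> L / measure \<mu> D) at_top" by (rule upper)
  have cpt: "compact (C + F)" if "finite F" for F
    using C_compact that by (simp add: compact_set_plus finite_imp_compact)
  show "eventually (\<lambda>i. f (A i) / measure \<mu> (A i) \<le> f (C + hit (A i)) / measure \<mu> (A i)) at_top"
  proof (intro always_eventually allI divide_right_mono)
    fix i show "f (A i) \<le> f (C + hit (A i))"
      using f net_compact cpt[OF finite_hit[OF net_compact]] hit_cover by (simp add: compact_subadditive_def)
  qed simp
  show "eventually (\<lambda>i. f (C + hit (A i)) / measure \<mu> (A i) - M / measure \<mu> D * (measure \<mu> (boundary C_minus_C (A i)) / measure \<mu> (A i))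
      \<le> f (A i) / measure \<mu> (A i)) at_top"
  proof (intro always_eventually allI)
    fix i
    have finf: "finite (fringe (A i))" using finite_hit[OF net_compact] by (simp add: fringe_def)
    have fringe\<Lambda>: "fringe (A i) \<subseteq> \<Lambda>" by (auto simp: fringe_def hit_def)
    have incl: "C + hit (A i) \<subseteq> A i \<union> (C + fringe (A i))"
    proof
      fix y assume "y \<in> C + hit (A i)"
      then obtain c s where y: "c \<in> C" "s \<in> hit (A i)" "y = c + s" by (auto simp: set_plus_def)
      then show "y \<in> A i \<union> (C + fringe (A i))" by (cases "s \<in> fringe (A i)") (auto simp: fringe_def)
    qed
    have "f (C + hit (A i)) \<le> f (A i \<union> (C + fringe (A i)))"
      using compact_subadditiveD(2)[OF f cpt[OF finite_hit[OF net_compact]] _ incl]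
        compact_Un[OF net_compact cpt[OF finf]] by blast
    also have "\<dots> \<le> f (A i) + f (C + fringe (A i))"
      using f cpt[OF finf] net_compact by (simp add: compact_subadditive_def)
    also have "f (C + fringe (A i)) \<le> M * real (card (fringe (A i)))"
      unfolding M_def by (rule subadditive_invariant_le_card[OF sub subgroup finf fringe\<Lambda>])
    also have "\<dots> \<le> M * (measure \<mu> (boundary C_minus_C (A i)) / measure \<mu> D)"
      using card_fringe[OF net_compact, of i] M measure_D_pos
      by (intro mult_left_mono) (auto simp: pos_le_divide_eq)
    finally have "f (C + hit (A i)) - M * (measure \<mu> (boundary C_minus_C (A i)) / measure \<mu> D) \<le> f (A i)" by simp
    then have "(f (C + hit (A i)) - M * (measure \<mu> (boundary C_minus_C (A i)) / measure \<mu> D)) / measure \<mu> (A i)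
        \<le> f (A i) / measure \<mu> (A i)" by (rule divide_right_mono) simp
    then show "f (C + hit (A i)) / measure \<mu> (A i) - M / measure \<mu> D * (measure \<mu> (boundary C_minus_C (A i)) / measure \<mu> (A i))
      \<le> f (A i) / measure \<mu> (A i)" by (simp add: diff_divide_distrib)
  qed
qed

text \<open>
  In an order that is not directed, \<open>at_top\<close> may be trivial; directedness of the index set enters
  here.
\<close>
lemma at_top_nontrivial: "(at_top :: 'i filter) \<noteq> bot"
  unfolding at_top_def
proof (rule INF_filter_not_bot)
  fix X :: "'i set" assume "finite X"
  then obtain b where b: "\<forall>x\<in>X. x \<le> b" using vH by (auto simp: van_hove_net_def bdd_above_def)
  have "principal {b..} \<le> (INF k\<in>X. principal {k..})"
    using b by (intro INF_greatest) auto
  moreover have "principal {b..} \<noteq> bot" by (simp add: principal_eq_bot_iff)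
  ultimately show "(INF k\<in>X. principal {k..}) \<noteq> bot" by (metis bot.extremum_uniqueI)
qed

lemma folner_nontrivial: "folner \<Lambda> \<noteq> bot"
proof
  assume "folner \<Lambda> = bot"
  then have "eventually (\<lambda>i. False) (at_top :: 'i filter)"
    using filterlim_hit[unfolded filterlim_iff, THEN spec, of "\<lambda>_. False"] by simp
  then show False using at_top_nontrivial by (simp add: trivial_limit_def)
qed

end

end

section \<open>Covering numbers of fibres and of tubes\<close>

lemma bowen_entourage_empty [simp]: "bowen_entourage \<phi> \<eta> {} = UNIV"
  by (auto simp: bowen_entourage_def)

lemma bowen_entourage_Un:
  "bowen_entourage \<phi> \<eta> (A \<union> B) = bowen_entourage \<phi> \<eta> A \<inter> bowen_entourage \<phi> \<eta> B"
  by (auto simp: bowen_entourage_def)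

lemma bowen_entourage_mono:
  "B \<subseteq> A \<Longrightarrow> \<eta> \<subseteq> \<theta> \<Longrightarrow> bowen_entourage \<phi> \<eta> A \<subseteq> bowen_entourage \<phi> \<theta> B"
  by (auto simp: bowen_entourage_def)

lemma entourages_mono: "\<eta> \<in> entourages \<Longrightarrow> \<eta> \<subseteq> \<theta> \<Longrightarrow> \<theta> \<in> entourages"
  unfolding entourages_def mem_Collect_eq by (meson order_trans)

lemma entourages_Int:
  assumes "\<eta> \<in> entourages" "\<theta> \<in> entourages" shows "\<eta> \<inter> \<theta> \<in> entourages"
proof -
  obtain V where V: "open V" "range (\<lambda>x. (x, x)) \<subseteq> V" "V \<subseteq> \<eta>"
    using assms(1) by (auto simp: entourages_def)
  obtain W where W: "open W" "range (\<lambda>x. (x, x)) \<subseteq> W" "W \<subseteq> \<theta>"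
    using assms(2) by (auto simp: entourages_def)
  show ?thesis
    unfolding entourages_def using V W by (intro CollectI exI[of _ "V \<inter> W"] conjI open_Int) auto
qed

lemma entourages_UNIV: "UNIV \<in> entourages"
  unfolding entourages_def by (intro CollectI exI[of _ UNIV]) auto

lemma entourage_contains_square:
  assumes \<eta>: "\<eta> \<in> entourages"
  shows "\<exists>U. open U \<and> x \<in> U \<and> U \<times> U \<subseteq> \<eta>"
proof -
  obtain W where W: "open W" "range (\<lambda>x. (x, x)) \<subseteq> W" "W \<subseteq> \<eta>"
    using \<eta> by (auto simp: entourages_def)
  have "(x, x) \<in> W" using W by blast
  then obtain A B where AB: "open A" "open B" "(x, x) \<in> A \<times> B" "A \<times> B \<subseteq> W"
    using open_prod_elim[OF W(1)] by metis
  then show ?thesis using W(3) by (intro exI[of _ "A \<inter> B"]) auto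
qed

lemma bowen_entourage_in_entourages:
  fixes \<phi> :: "'g::topological_group_add \<Rightarrow> 'x::topological_space \<Rightarrow> 'x"
  assumes act: "top_action \<phi>" and A: "compact A" and \<eta>: "\<eta> \<in> entourages"
  shows "bowen_entourage \<phi> \<eta> A \<in> entourages"
proof -
  obtain W where W: "open W" "range (\<lambda>x. (x, x)) \<subseteq> W" "W \<subseteq> \<eta>"
    using \<eta> by (auto simp: entourages_def)
  have cont: "continuous_on UNIV (\<lambda>z. \<phi> (fst z) (snd z))"
    using act by (simp add: top_action_def case_prod_beta')
  have "continuous_on UNIV (\<lambda>z::'g \<times> 'x \<times> 'x. \<phi> (fst z) (fst (snd z)))"
  proof -
    have "continuous_on UNIV (\<lambda>z::'g \<times> 'x \<times> 'x. (fst z, fst (snd z)))" by (intro continuous_intros)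
    from continuous_on_compose2[OF cont this] show ?thesis by simp
  qed
  moreover have "continuous_on UNIV (\<lambda>z::'g \<times> 'x \<times> 'x. \<phi> (fst z) (snd (snd z)))"
  proof -
    have "continuous_on UNIV (\<lambda>z::'g \<times> 'x \<times> 'x. (fst z, snd (snd z)))" by (intro continuous_intros)
    from continuous_on_compose2[OF cont this] show ?thesis by simp
  qed
  ultimately have
    "open ((\<lambda>z::'g \<times> 'x \<times> 'x. (\<phi> (fst z) (fst (snd z)), \<phi> (fst z) (snd (snd z)))) -` W)"
    using W by (intro open_vimage continuous_on_Pair)
  from open_forall_compact[OF A this]
  have "open (bowen_entourage \<phi> W A)" by (simp add: bowen_entourage_def case_prod_beta')
  moreover have "range (\<lambda>x. (x, x)) \<subseteq> bowen_entourage \<phi> W A"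
    using W by (auto simp: bowen_entourage_def)
  moreover have "bowen_entourage \<phi> W A \<subseteq> bowen_entourage \<phi> \<eta> A"
    using W by (intro bowen_entourage_mono) auto
  ultimately show ?thesis unfolding entourages_def by blast
qed

lemma top_actionD:
  assumes "top_action \<phi>"
  shows "\<phi> 0 x = x" "\<phi> g (\<phi> h x) = \<phi> (g + h) x"
  using assms by (auto simp: top_action_def)

lemma top_action_continuous:
  assumes "top_action \<phi>" shows "continuous_on UNIV (\<phi> g)"
proof -
  have cont: "continuous_on UNIV (\<lambda>z. \<phi> (fst z) (snd z))"
    using assms by (simp add: top_action_def case_prod_beta')
  have "continuous_on UNIV (\<lambda>x. (g, x))" by (intro continuous_intros)
  from continuous_on_compose2[OF cont this] show ?thesis by simp
qed

lemma compact_t2_separation: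
  fixes U :: "'x::t2_space set"
  assumes X: "compact (UNIV :: 'x set)" and U: "open U" "x \<in> U"
  obtains V N where "open V" "open N" "x \<in> V" "- U \<subseteq> N" "V \<inter> N = {}"
proof -
  have "Hausdorff_space (euclidean :: 'x topology)"
    unfolding Hausdorff_space_def disjnt_def 
  proof (intro allI impI)
    fix x y :: 'x assume "x \<in> topspace euclidean \<and> y \<in> topspace euclidean \<and> x \<noteq> y"
    then have "x \<noteq> y" by simp
    from hausdorff[OF this]
    show "\<exists>U V. openin euclidean U \<and> openin euclidean V \<and> x \<in> U \<and> y \<in> V \<and> U \<inter> V = {}"
      by simp
  qed
  moreover have "compact_space (euclidean :: 'x topology)" using X by (simp add: compact_space_def)
  ultimately have "regular_space (euclidean :: 'x topology)"
    by (intro compact_Hausdorff_imp_regular_space)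
  then have "\<exists>V N. open V \<and> open N \<and> x \<in> V \<and> - U \<subseteq> N \<and> disjnt V N"
    using U unfolding regular_space_def by (auto simp: closed_Compl)
  then show thesis using that by (auto simp: disjnt_def)
qed

text \<open>
  A Lebesgue number lemma for compact Hausdorff spaces. Choose disjoint open sets \<open>V x \<ni> x\<close> and
  \<open>N x \<supseteq> - U x\<close>, and finitely many \<open>V x\<close> that cover the space. Points related by
  \<open>U x \<times> U x \<union> N x \<times> N x\<close> to a point of \<open>V x\<close>, which is outside \<open>N x\<close>, lie in \<open>U x\<close>.
\<close>
lemma entourage_subordinate_to_cover:
  fixes U :: "'x::t2_space \<Rightarrow> 'x set"
  assumes X: "compact (UNIV :: 'x set)" and U: "\<And>x. open (U x)" "\<And>x. x \<in> U x"
  obtains V where "open V" "range (\<lambda>x. (x, x)) \<subseteq> V" "sym V" "\<And>y. \<exists>x. V `` {y} \<subseteq> U x"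
proof -
  have "\<exists>V N. open V \<and> open N \<and> x \<in> V \<and> - U x \<subseteq> N \<and> V \<inter> N = {}" for x
    using compact_t2_separation[OF X U(1)[of x] U(2)[of x]] by metis
  then obtain V N where VN: "\<And>x. open (V x)" "\<And>x. open (N x)" "\<And>x. x \<in> V x"
    "\<And>x. - U x \<subseteq> N x" "\<And>x. V x \<inter> N x = {}" by metis
  obtain J where J: "finite J" "UNIV \<subseteq> (\<Union>x\<in>J. V x)"
    using compactE_image[OF X, of UNIV V] VN(1,3) by (metis UNIV_I UN_I subsetI)
  define W where "W = (\<Inter>x\<in>J. (U x \<times> U x) \<union> (N x \<times> N x))"
  show thesis
  proof (rule that[of W])
    show "open W" unfolding W_def using J(1) U(1) VN(2) by (intro open_INT open_Un open_Times ballI)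
    show "range (\<lambda>x. (x, x)) \<subseteq> W" using VN(4) by (auto simp: W_def)
    show "sym W" by (auto simp: W_def sym_def)
    fix y
    obtain x where x: "x \<in> J" "y \<in> V x" using J by blast
    have "W `` {y} \<subseteq> U x" using x VN(5)[of x] by (auto simp: W_def)
    then show "\<exists>x. W `` {y} \<subseteq> U x" by blast
  qed
qed

lemma entourage_half:
  fixes \<eta> :: "('x::t2_space \<times> 'x) set"
  assumes X: "compact (UNIV :: 'x set)" and \<eta>: "\<eta> \<in> entourages"
  obtains V where "open V" "range (\<lambda>x. (x, x)) \<subseteq> V" "sym V" "V O V \<subseteq> \<eta>"
proof -
  obtain U where U: "\<And>x. open (U x)" "\<And>x. x \<in> U x" "\<And>x. U x \<times> U x \<subseteq> \<eta>"
    using entourage_contains_square[OF \<eta>] by metis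
  obtain V where V: "open V" "range (\<lambda>x. (x, x)) \<subseteq> V" "sym V" "\<And>y. \<exists>x. V `` {y} \<subseteq> U x"
    by (rule entourage_subordinate_to_cover[of U, OF X U(1,2)]) metis
  have "V O V \<subseteq> \<eta>"
  proof (intro subrelI)
    fix a c assume "(a, c) \<in> V O V"
    then obtain b where b: "(a, b) \<in> V" "(b, c) \<in> V" by blast
    obtain x where x: "V `` {b} \<subseteq> U x" using V(4) by blast
    have "(b, a) \<in> V" using b V(3) by (auto simp: sym_def)
    then have "a \<in> U x" "c \<in> U x" using x b by blast+
    then show "(a, c) \<in> \<eta>" using U(3)[of x] by blast
  qed
  then show thesis using that V by blast
qed

text \<open>
  Covers by at most \<open>n\<close> sets are easier to combine than minimal cardinalities; by \<open>cov_le_iff\<close> they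
  carry the same information.
\<close>
definition coverable :: "'x::topological_space set \<Rightarrow> nat \<Rightarrow> ('x \<times> 'x) set \<Rightarrow> bool" where
  "coverable M n \<eta> \<longleftrightarrow>
     (\<exists>\<U>. finite \<U> \<and> card \<U> \<le> n \<and> M \<subseteq> \<Union>\<U> \<and> (\<forall>U\<in>\<U>. open U \<and> U \<times> U \<subseteq> \<eta>))"

lemma cov_le_iff: "cov M \<eta> \<le> enat n \<longleftrightarrow> coverable M n \<eta>"
proof
  let ?S = "{enat (card \<U>) | \<U>. finite \<U> \<and> M \<subseteq> \<Union>\<U> \<and> (\<forall>U\<in>\<U>. open U \<and> U \<times> U \<subseteq> \<eta>)}"
  assume le: "cov M \<eta> \<le> enat n"
  then have "?S \<noteq> {}" unfolding cov_def by (auto simp: Inf_enat_def split: if_splits)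
  then have "Inf ?S \<in> ?S" unfolding Inf_enat_def by (auto intro: LeastI)
  then obtain \<U> where "Inf ?S = enat (card \<U>)" "finite \<U>" "M \<subseteq> \<Union>\<U>"
    "\<forall>U\<in>\<U>. open U \<and> U \<times> U \<subseteq> \<eta>" by auto
  then show "coverable M n \<eta>" using le unfolding cov_def coverable_def by auto
next
  assume "coverable M n \<eta>"
  then obtain \<U> where U: "finite \<U>" "card \<U> \<le> n" "M \<subseteq> \<Union>\<U>"
    "\<forall>U\<in>\<U>. open U \<and> U \<times> U \<subseteq> \<eta>" unfolding coverable_def by metis
  have "cov M \<eta> \<le> enat (card \<U>)" unfolding cov_def using U by (intro Inf_lower) blast
  also have "\<dots> \<le> enat n" using U by simp
  finally show "cov M \<eta> \<le> enat n" .
qed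

lemma coverable_mono:
  "coverable N n \<eta> \<Longrightarrow> M \<subseteq> N \<Longrightarrow> n \<le> m \<Longrightarrow> \<eta> \<subseteq> \<theta> \<Longrightarrow> coverable M m \<theta>"
  unfolding coverable_def by (meson order_trans)

lemma coverable_Int:
  assumes "coverable M m \<eta>" "coverable M n \<theta>"
  shows "coverable M (m * n) (\<eta> \<inter> \<theta>)"
proof -
  obtain \<U> \<V> where U: "finite \<U>" "card \<U> \<le> m" "M \<subseteq> \<Union>\<U>" "\<forall>U\<in>\<U>. open U \<and> U \<times> U \<subseteq> \<eta>"
    and V: "finite \<V>" "card \<V> \<le> n" "M \<subseteq> \<Union>\<V>" "\<forall>V\<in>\<V>. open V \<and> V \<times> V \<subseteq> \<theta>"
    using assms unfolding coverable_def by metis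
  let ?W = "(\<lambda>(U, V). U \<inter> V) ` (\<U> \<times> \<V>)"
  have "card ?W \<le> card (\<U> \<times> \<V>)" using U V by (intro card_image_le) auto
  also have "\<dots> \<le> m * n" using U V by (simp add: card_cartesian_product mult_le_mono)
  finally have "card ?W \<le> m * n" .
  moreover have "M \<subseteq> \<Union>?W" using U(3) V(3) by fastforce
  moreover have "\<forall>W\<in>?W. open W \<and> W \<times> W \<subseteq> \<eta> \<inter> \<theta>" using U(4) V(4) by fastforce
  ultimately show ?thesis unfolding coverable_def using U V by (intro exI[of _ ?W]) auto
qed

lemma coverable_vimage:
  assumes cov: "coverable N n \<eta>" and f: "continuous_on UNIV f" and MN: "f ` M \<subseteq> N"
    and sub: "\<And>x y. (f x, f y) \<in> \<eta> \<Longrightarrow> (x, y) \<in> \<theta>"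
  shows "coverable M n \<theta>"
proof -
  obtain \<U> where U: "finite \<U>" "card \<U> \<le> n" "N \<subseteq> \<Union>\<U>" "\<forall>U\<in>\<U>. open U \<and> U \<times> U \<subseteq> \<eta>"
    using cov unfolding coverable_def by metis
  have "card ((-`) f ` \<U>) \<le> n" using card_image_le[OF U(1), of "(-`) f"] U(2) by linarith
  moreover have "M \<subseteq> \<Union>((-`) f ` \<U>)" using MN U(3) by fastforce
  moreover have "open (f -` U)" if "U \<in> \<U>" for U using U(4) f that by (intro open_vimage) auto
  moreover have "f -` U \<times> f -` U \<subseteq> \<theta>" if "U \<in> \<U>" for U using U(4) that sub by blast
  ultimately show ?thesis unfolding coverable_def using U(1)
    by (intro exI[of _ "(-`) f ` \<U>"]) blast
qed

lemma entourage_coverable: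
  fixes \<eta> :: "('x::topological_space \<times> 'x) set"
  assumes X: "compact (UNIV :: 'x set)" and \<eta>: "\<eta> \<in> entourages"
  obtains n where "coverable UNIV n \<eta>"
proof -
  obtain U where U: "\<And>x. open (U x)" "\<And>x. x \<in> U x" "\<And>x. U x \<times> U x \<subseteq> \<eta>"
    using entourage_contains_square[OF \<eta>] by metis
  obtain J where J: "finite J" "UNIV \<subseteq> (\<Union>x\<in>J. U x)"
    using compactE_image[OF X, of UNIV U] U(1,2) by (metis UNIV_I UN_I subsetI)
  have "coverable UNIV (card (U ` J)) \<eta>"
    unfolding coverable_def using J U by (intro exI[of _ "U ` J"]) blast
  then show thesis by (rule that)
qed

text \<open>
  For the family of fibres of \<open>p\<close> this is the number \<open>cov_map p \<eta>\<close>, which is finite if the space is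
  compact and \<open>\<eta>\<close> is an entourage. Other families are needed for tubes.
\<close>
definition cov_family :: "'x::topological_space set set \<Rightarrow> ('x \<times> 'x) set \<Rightarrow> nat" where
  "cov_family \<M> \<eta> = the_enat (SUP M\<in>\<M>. cov M \<eta>)"

lemma enat_cov_family:
  fixes \<M> :: "'x::topological_space set set"
  assumes "compact (UNIV :: 'x set)" "\<eta> \<in> entourages"
  shows "enat (cov_family \<M> \<eta>) = (SUP M\<in>\<M>. cov M \<eta>)"
proof -
  obtain n where n: "coverable (UNIV :: 'x set) n \<eta>" using entourage_coverable[OF assms] .
  have "(SUP M\<in>\<M>. cov M \<eta>) \<le> enat n"
    using n by (intro SUP_least) (auto simp: cov_le_iff intro: coverable_mono)
  then have "(SUP M\<in>\<M>. cov M \<eta>) \<noteq> \<infinity>" by (metis enat_ord_simps(5) infinity_ne_i0 enat.distinct(1))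
  then show ?thesis unfolding cov_family_def by (metis enat.exhaust the_enat.simps)
qed

lemma cov_family_le_iff:
  fixes \<M> :: "'x::topological_space set set"
  assumes "compact (UNIV :: 'x set)" "\<eta> \<in> entourages"
  shows "cov_family \<M> \<eta> \<le> n \<longleftrightarrow> (\<forall>M\<in>\<M>. coverable M n \<eta>)"
proof -
  have "cov_family \<M> \<eta> \<le> n \<longleftrightarrow> enat (cov_family \<M> \<eta>) \<le> enat n" by simp
  also have "\<dots> \<longleftrightarrow> (\<forall>M\<in>\<M>. coverable M n \<eta>)"
    unfolding enat_cov_family[OF assms] by (simp add: SUP_le_iff cov_le_iff)
  finally show ?thesis .
qed

lemma coverable_cov_family:
  fixes \<M> :: "'x::topological_space set set"
  assumes "compact (UNIV :: 'x set)" "\<eta> \<in> entourages" "M \<in> \<M>"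
  shows "coverable M (cov_family \<M> \<eta>) \<eta>"
  using cov_family_le_iff[OF assms(1,2)] assms(3) by blast

lemma cov_family_pos:
  fixes \<M> :: "'x::topological_space set set"
  assumes "compact (UNIV :: 'x set)" "\<eta> \<in> entourages" "M \<in> \<M>" "M \<noteq> {}"
  shows "0 < cov_family \<M> \<eta>"
proof (rule ccontr)
  assume "\<not> ?thesis"
  then have "coverable M 0 \<eta>" using coverable_cov_family[OF assms(1,2,3)] by simp
  then show False using assms(4) by (auto simp: coverable_def)
qed

lemma cov_family_mono:
  fixes \<M> \<N> :: "'x::topological_space set set"
  assumes "compact (UNIV :: 'x set)" "\<eta> \<in> entourages" "\<eta> \<subseteq> \<theta>"
    "\<And>M. M \<in> \<M> \<Longrightarrow> \<exists>N\<in>\<N>. M \<subseteq> N"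
  shows "cov_family \<M> \<theta> \<le> cov_family \<N> \<eta>"
  unfolding cov_family_le_iff[OF assms(1) entourages_mono[OF assms(2,3)]]
proof
  fix M assume "M \<in> \<M>"
  then obtain N where N: "N \<in> \<N>" "M \<subseteq> N" using assms(4) by blast
  show "coverable M (cov_family \<N> \<eta>) \<theta>"
    using coverable_cov_family[OF assms(1,2) N(1)] N(2) _ assms(3) by (rule coverable_mono) simp
qed

lemma cov_family_UNIV:
  fixes \<M> :: "'x::topological_space set set"
  assumes "compact (UNIV :: 'x set)" "M \<in> \<M>" "M \<noteq> {}"
  shows "cov_family \<M> UNIV = 1"
proof -
  have "cov_family \<M> UNIV \<le> 1"
    unfolding cov_family_le_iff[OF assms(1) entourages_UNIV]
    by (auto simp: coverable_def intro!: exI[of _ "{UNIV}"])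
  then show ?thesis using cov_family_pos[OF assms(1) entourages_UNIV assms(2,3)] by simp
qed

lemma bowen_entourage_translate:
  fixes \<phi> :: "'g::topological_group_add \<Rightarrow> 'x::topological_space \<Rightarrow> 'x"
  assumes "top_action \<phi>"
  shows "(x, y) \<in> bowen_entourage \<phi> \<eta> ((\<lambda>a. a + g) ` A) \<longleftrightarrow> (\<phi> g x, \<phi> g y) \<in> bowen_entourage \<phi> \<eta> A"
  by (simp add: bowen_entourage_def top_actionD(2)[OF assms])

lemma right_translate_back: "(\<lambda>a. a + - g) ` (\<lambda>a. a + g) ` A = (A :: 'g::group_add set)"
  by (simp add: image_image add.assoc)

text \<open>
  Pulling a cover back along \<open>\<phi> g\<close> turns sets that are small along \<open>A\<close> into sets that are small
  along \<open>A + g\<close>. Applied to \<open>g\<close> and to \<open>- g\<close> this gives right invariance.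
\<close>
lemma cov_family_translate_le:
  fixes \<phi> :: "'g::topological_group_add \<Rightarrow> 'x::topological_space \<Rightarrow> 'x"
  assumes X: "compact (UNIV :: 'x set)" and act: "top_action \<phi>"
    and A: "compact A" and \<eta>: "\<eta> \<in> entourages"
    and MN: "\<And>M. M \<in> \<M> \<Longrightarrow> \<phi> g ` M \<in> \<N>"
  shows "cov_family \<M> (bowen_entourage \<phi> \<eta> ((\<lambda>a. a + g) ` A)) \<le> cov_family \<N> (bowen_entourage \<phi> \<eta> A)"
proof -
  have Ag: "compact ((\<lambda>a. a + g) ` A)"
    using A by (intro compact_continuous_image) (auto intro!: continuous_intros)
  note ent = bowen_entourage_in_entourages[OF act _ \<eta>]
  show ?thesis
    unfolding cov_family_le_iff[OF X ent[OF Ag]]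
  proof
    fix M assume "M \<in> \<M>"
    then have "coverable (\<phi> g ` M) (cov_family \<N> (bowen_entourage \<phi> \<eta> A)) (bowen_entourage \<phi> \<eta> A)"
      by (intro coverable_cov_family[OF X ent[OF A]] MN)
    then show "coverable M (cov_family \<N> (bowen_entourage \<phi> \<eta> A)) (bowen_entourage \<phi> \<eta> ((\<lambda>a. a + g) ` A))"
      by (rule coverable_vimage[OF _ top_action_continuous[OF act]])
        (auto simp: bowen_entourage_translate[OF act])
  qed
qed

text \<open>Intersecting the members of two covers gives a cover by sets small along \<open>A \<union> B\<close>.\<close>
lemma ln_cov_family_Un:
  fixes \<phi> :: "'g::topological_group_add \<Rightarrow> 'x::topological_space \<Rightarrow> 'x"
  assumes X: "compact (UNIV :: 'x set)" and act: "top_action \<phi>"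
    and A: "compact A" and B: "compact B" and \<eta>: "\<eta> \<in> entourages"
    and sub: "\<M> \<subseteq> \<M>1" "\<M> \<subseteq> \<M>2" and ne: "M \<in> \<M>" "M \<noteq> {}"
  shows "ln (real (cov_family \<M> (bowen_entourage \<phi> \<eta> (A \<union> B)))) \<le>
    ln (real (cov_family \<M>1 (bowen_entourage \<phi> \<eta> A))) + ln (real (cov_family \<M>2 (bowen_entourage \<phi> \<eta> B)))"
proof -
  note ent = bowen_entourage_in_entourages[OF act _ \<eta>]
  let ?a = "cov_family \<M>1 (bowen_entourage \<phi> \<eta> A)" and ?b = "cov_family \<M>2 (bowen_entourage \<phi> \<eta> B)"
  have pos: "0 < cov_family \<M> (bowen_entourage \<phi> \<eta> (A \<union> B))" "0 < ?a" "0 < ?b"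
    using cov_family_pos[OF X ent[OF compact_Un[OF A B]] ne]
      cov_family_pos[OF X ent[OF A] subsetD[OF sub(1) ne(1)] ne(2)]
      cov_family_pos[OF X ent[OF B] subsetD[OF sub(2) ne(1)] ne(2)] by simp_all
  have "cov_family \<M> (bowen_entourage \<phi> \<eta> (A \<union> B)) \<le> ?a * ?b"
    unfolding cov_family_le_iff[OF X ent[OF compact_Un[OF A B]]]
  proof
    fix M assume "M \<in> \<M>"
    then show "coverable M (?a * ?b) (bowen_entourage \<phi> \<eta> (A \<union> B))"
      unfolding bowen_entourage_Un using sub
      by (intro coverable_Int coverable_cov_family[OF X ent] A B) auto
  qed
  then have "real (cov_family \<M> (bowen_entourage \<phi> \<eta> (A \<union> B))) \<le> real ?a * real ?b"
    by (metis of_nat_le_iff of_nat_mult)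
  then have "ln (real (cov_family \<M> (bowen_entourage \<phi> \<eta> (A \<union> B)))) \<le> ln (real ?a * real ?b)"
    using pos by (intro ln_mono) auto
  then show ?thesis using pos by (simp add: ln_mult)
qed

definition fibres :: "('x \<Rightarrow> 'y) \<Rightarrow> 'x set set" where
  "fibres p = range (\<lambda>y. p -` {y})"

definition tubes :: "('x \<Rightarrow> 'y) \<Rightarrow> ('y \<times> 'y) set \<Rightarrow> 'x set set" where
  "tubes p \<xi> = {p -` U | U. U \<noteq> {} \<and> U \<times> U \<subseteq> \<xi>}"

lemma factor_mapD:
  assumes "factor_map \<phi> \<psi> p"
  shows "continuous_on UNIV p" "surj p" "p (\<phi> g x) = \<psi> g (p x)"
  using assms by (auto simp: factor_map_def fun_eq_iff)

lemma image_vimage_equivariant: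
  assumes "top_action \<phi>" "top_action \<psi>" "factor_map \<phi> \<psi> p"
  shows "\<phi> g ` (p -` U) = p -` (\<psi> g ` U)"
proof (intro set_eqI iffI)
  fix x assume "x \<in> \<phi> g ` (p -` U)"
  then show "x \<in> p -` (\<psi> g ` U)" by (auto simp: factor_mapD(3)[OF assms(3)])
next
  fix x assume "x \<in> p -` (\<psi> g ` U)"
  then obtain u where u: "u \<in> U" "p x = \<psi> g u" by auto
  have "p (\<phi> (- g) x) = u"
    by (simp add: factor_mapD(3)[OF assms(3)] u top_actionD[OF assms(2)])
  moreover have "x = \<phi> g (\<phi> (- g) x)" by (simp add: top_actionD[OF assms(1)])
  ultimately show "x \<in> \<phi> g ` (p -` U)" using u by (metis imageI vimageI)
qed

lemma fibres_translate:
  assumes "top_action \<phi>" "top_action \<psi>" "factor_map \<phi> \<psi> p" "M \<in> fibres p"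
  shows "\<phi> g ` M \<in> fibres p"
  using assms(4) image_vimage_equivariant[OF assms(1-3)] by (auto simp: fibres_def)

lemma tubes_translate:
  assumes "top_action \<phi>" "top_action \<psi>" "factor_map \<phi> \<psi> p"
    "M \<in> tubes p (bowen_entourage \<psi> \<theta> ((\<lambda>a. a + g) ` A))"
  shows "\<phi> g ` M \<in> tubes p (bowen_entourage \<psi> \<theta> A)"
proof -
  obtain U where U: "M = p -` U" "U \<noteq> {}" "U \<times> U \<subseteq> bowen_entourage \<psi> \<theta> ((\<lambda>a. a + g) ` A)"
    using assms(4) by (auto simp: tubes_def)
  have "\<psi> g ` U \<times> \<psi> g ` U \<subseteq> bowen_entourage \<psi> \<theta> A"
    using U(3) by (auto simp: bowen_entourage_translate[OF assms(2), symmetric])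
  moreover have "\<phi> g ` M = p -` (\<psi> g ` U)" "\<psi> g ` U \<noteq> {}"
    using U image_vimage_equivariant[OF assms(1-3), of g U] by simp_all
  ultimately show ?thesis unfolding tubes_def by blast
qed

lemma tubes_mono: "\<xi> \<subseteq> \<zeta> \<Longrightarrow> tubes p \<xi> \<subseteq> tubes p \<zeta>"
  unfolding tubes_def by blast

lemma fibres_nonempty: "surj p \<Longrightarrow> \<exists>M\<in>fibres p. M \<noteq> {}"
  unfolding fibres_def by (auto simp: surj_def)

lemma tubes_nonempty:
  assumes "surj p" "\<xi> \<in> entourages" shows "\<exists>M\<in>tubes p \<xi>. M \<noteq> {}"
proof -
  have "(y, y) \<in> \<xi>" for y using assms(2) by (auto simp: entourages_def)
  then have "p -` {undefined} \<in> tubes p \<xi>"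
    unfolding tubes_def by (intro CollectI exI[of _ "{undefined}"]) auto
  moreover have "p -` {undefined} \<noteq> {}"
  proof -
    obtain x where "undefined = p x" using assms(1) by (rule surjE)
    then have "x \<in> p -` {undefined}" by simp
    then show ?thesis by blast
  qed
  ultimately show ?thesis by (rule bexI[rotated])
qed

text \<open>
  Cover a fibre of \<open>q\<close> by sets that are small of order \<open>\<theta>\<close>, and then cover the preimage of each of
  them.
\<close>
lemma cov_family_composite:
  fixes p :: "'x::topological_space \<Rightarrow> 'y::topological_space" and q :: "'y \<Rightarrow> 'z"
  assumes X: "compact (UNIV :: 'x set)" and Y: "compact (UNIV :: 'y set)"
    and \<eta>: "\<eta> \<in> entourages" and \<theta>: "\<theta> \<in> entourages"
  shows "cov_family (fibres (q \<circ> p)) \<eta> \<le> cov_family (fibres q) \<theta> * cov_family (tubes p \<theta>) \<eta>"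
  unfolding cov_family_le_iff[OF X \<eta>]
proof
  let ?n = "cov_family (fibres q) \<theta>" and ?m = "cov_family (tubes p \<theta>) \<eta>"
  fix M assume "M \<in> fibres (q \<circ> p)"
  then obtain z where M: "M = p -` (q -` {z})" by (auto simp: fibres_def vimage_comp)
  have "q -` {z} \<in> fibres q" by (simp add: fibres_def)
  then obtain \<U> where U: "finite \<U>" "card \<U> \<le> ?n" "q -` {z} \<subseteq> \<Union>\<U>" "\<forall>U\<in>\<U>. open U \<and> U \<times> U \<subseteq> \<theta>"
    using coverable_cov_family[OF Y \<theta>] unfolding coverable_def by metis
  have "coverable (p -` U) ?m \<eta>" if "U \<in> \<U>" for U
  proof (cases "U = {}")
    case True
    then show ?thesis by (auto simp: coverable_def intro!: exI[of _ "{}"])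
  next
    case False
    then have "p -` U \<in> tubes p \<theta>" using U(4) that unfolding tubes_def by blast
    then show ?thesis by (rule coverable_cov_family[OF X \<eta>])
  qed
  then obtain \<V> where V: "\<And>U. U \<in> \<U> \<Longrightarrow> finite (\<V> U) \<and> card (\<V> U) \<le> ?m \<and> p -` U \<subseteq> \<Union>(\<V> U) \<and>
      (\<forall>V\<in>\<V> U. open V \<and> V \<times> V \<subseteq> \<eta>)" unfolding coverable_def by metis
  have "card (\<Union>U\<in>\<U>. \<V> U) \<le> (\<Sum>U\<in>\<U>. card (\<V> U))" using U by (intro card_UN_le)
  also have "\<dots> \<le> (\<Sum>U\<in>\<U>. ?m)" using V by (intro sum_mono) auto
  also have "\<dots> = card \<U> * ?m" by simp
  also have "\<dots> \<le> ?n * ?m" using U by (intro mult_le_mono1)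
  finally have "card (\<Union>U\<in>\<U>. \<V> U) \<le> ?n * ?m" .
  moreover have "M \<subseteq> \<Union>(\<Union>U\<in>\<U>. \<V> U)"
  proof
    fix x assume "x \<in> M"
    then obtain U where "U \<in> \<U>" "p x \<in> U" using U(3) M by blast
    then show "x \<in> \<Union>(\<Union>U\<in>\<U>. \<V> U)" using V[of U] by blast
  qed
  ultimately show "coverable M (?n * ?m) \<eta>"
    unfolding coverable_def using U(1) V by (intro exI[of _ "\<Union>U\<in>\<U>. \<V> U"]) auto
qed

text \<open>
  A cover of a fibre \<open>p -` {y}\<close> also covers \<open>p -` B\<close> for a neighbourhood \<open>B\<close> of \<open>y\<close>, because \<open>p\<close> maps the
  closed complement of the cover to a closed set. If \<open>\<xi>\<close> is subordinate to these neighbourhoods, then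
  every tube of order \<open>\<xi>\<close> is contained in one of the sets \<open>p -` B\<close>.
\<close>
lemma tubes_refine_to_fibres:
  fixes p :: "'x::t2_space \<Rightarrow> 'y::t2_space"
  assumes X: "compact (UNIV :: 'x set)" and Y: "compact (UNIV :: 'y set)"
    and p: "continuous_on UNIV p" and \<eta>: "\<eta> \<in> entourages"
  obtains \<xi> where "\<xi> \<in> entourages" "cov_family (tubes p \<xi>) \<eta> \<le> cov_family (fibres p) \<eta>"
proof -
  let ?n = "cov_family (fibres p) \<eta>"
  have "\<exists>B. open B \<and> y \<in> B \<and> coverable (p -` B) ?n \<eta>" for y
  proof -
    have "p -` {y} \<in> fibres p" by (simp add: fibres_def)
    then obtain \<U> where U: "finite \<U>" "card \<U> \<le> ?n" "p -` {y} \<subseteq> \<Union>\<U>" "\<forall>U\<in>\<U>. open U \<and> U \<times> U \<subseteq> \<eta>"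
      using coverable_cov_family[OF X \<eta>] unfolding coverable_def by metis
    have "closed (- \<Union>\<U>)" using U by (auto simp: closed_def intro: open_Union)
    then have "compact (- \<Union>\<U>)" using compact_Int_closed[OF X] by simp
    then have "compact (p ` (- \<Union>\<U>))" using p by (intro compact_continuous_image) (auto intro: continuous_on_subset)
    then have "open (- p ` (- \<Union>\<U>))" by (intro open_Compl compact_imp_closed)
    moreover have "y \<in> - p ` (- \<Union>\<U>)" using U(3) by blast
    moreover have "p -` (- p ` (- \<Union>\<U>)) \<subseteq> \<Union>\<U>" by blast
    then have "coverable (p -` (- p ` (- \<Union>\<U>))) ?n \<eta>" unfolding coverable_def using U by blast
    ultimately show ?thesis by blast
  qed
  then obtain B where B: "\<And>y. open (B y)" "\<And>y. y \<in> B y" "\<And>y. coverable (p -` B y) ?n \<eta>" by metis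
  obtain \<xi> where \<xi>: "open \<xi>" "range (\<lambda>x. (x, x)) \<subseteq> \<xi>" "\<And>y. \<exists>x. \<xi> `` {y} \<subseteq> B x"
    by (rule entourage_subordinate_to_cover[of B, OF Y B(1,2)]) metis
  have "cov_family (tubes p \<xi>) \<eta> \<le> ?n"
    unfolding cov_family_le_iff[OF X \<eta>]
  proof
    fix M assume "M \<in> tubes p \<xi>"
    then obtain U y where U: "M = p -` U" "y \<in> U" "U \<times> U \<subseteq> \<xi>" by (auto simp: tubes_def)
    obtain x where "\<xi> `` {y} \<subseteq> B x" using \<xi>(3) by blast
    then have "M \<subseteq> p -` B x" using U by blast
    then show "coverable M ?n \<eta>" using B(3)[of x] coverable_mono by blast
  qed
  moreover have "\<xi> \<in> entourages" using \<xi> by (auto simp: entourages_def)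
  ultimately show thesis using that by blast
qed

text \<open>
  The image under \<open>p\<close> of a set that is small of order \<open>\<zeta>\<close> is small of order \<open>\<theta>\<close> but need not be
  open. Its neighbourhood with respect to an open part of \<open>\<theta>\<close> is open, and small of order
  \<open>\<theta>\<inverse> O \<theta> O \<theta>\<close>.
\<close>
lemma cov_family_of_factor_le:
  fixes p :: "'x::t2_space \<Rightarrow> 'y::t2_space" and q :: "'y \<Rightarrow> 'z"
  assumes X: "compact (UNIV :: 'x set)" and Y: "compact (UNIV :: 'y set)" and p: "surj p"
    and \<zeta>: "\<zeta> \<in> entourages" and \<theta>: "\<theta> \<in> entourages" and \<eta>: "\<eta> \<in> entourages"
    and \<zeta>\<theta>: "\<And>x x'. (x, x') \<in> \<zeta> \<Longrightarrow> (p x, p x') \<in> \<theta>" and comp: "\<theta>\<inverse> O \<theta> O \<theta> \<subseteq> \<eta>"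
  shows "cov_family (fibres q) \<eta> \<le> cov_family (fibres (q \<circ> p)) \<zeta>"
  unfolding cov_family_le_iff[OF Y \<eta>]
proof
  let ?n = "cov_family (fibres (q \<circ> p)) \<zeta>"
  fix N assume "N \<in> fibres q"
  then have "p -` N \<in> fibres (q \<circ> p)" by (auto simp: fibres_def vimage_comp)
  then obtain \<U> where U: "finite \<U>" "card \<U> \<le> ?n" "p -` N \<subseteq> \<Union>\<U>" "\<forall>U\<in>\<U>. open U \<and> U \<times> U \<subseteq> \<zeta>"
    using coverable_cov_family[OF X \<zeta>] unfolding coverable_def by metis
  obtain W where W: "open W" "range (\<lambda>x. (x, x)) \<subseteq> W" "W \<subseteq> \<theta>" using \<theta> by (auto simp: entourages_def)
  define V where "V U = W `` (p ` U)" for U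
  have opV: "open (V U)" for U
  proof -
    have "V U = (\<Union>y\<in>p ` U. (\<lambda>y'. (y, y')) -` W)" by (auto simp: V_def)
    moreover have "open ((\<lambda>y'. (y, y')) -` W)" for y
      using W by (intro open_vimage) (auto intro!: continuous_intros)
    ultimately show ?thesis by auto
  qed
  have VV: "V U \<times> V U \<subseteq> \<eta>" if "U \<in> \<U>" for U
  proof (clarify)
    fix a b assume "a \<in> V U" "b \<in> V U"
    then obtain x y where "x \<in> U" "y \<in> U" "(p x, a) \<in> W" "(p y, b) \<in> W" by (auto simp: V_def)
    moreover have "(x, y) \<in> \<zeta>" using U(4) that \<open>x \<in> U\<close> \<open>y \<in> U\<close> by blast
    then have "(p x, p y) \<in> \<theta>" by (rule \<zeta>\<theta>)
    ultimately show "(a, b) \<in> \<eta>" using W(3) comp by blast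
  qed
  have "N \<subseteq> \<Union>(V ` \<U>)"
  proof
    fix y assume y: "y \<in> N"
    obtain x where x: "y = p x" using p by blast
    then obtain U where "U \<in> \<U>" "x \<in> U" using U(3) y by blast
    moreover have "p x \<in> V U"
      unfolding V_def using subsetD[OF W(2) rangeI] \<open>x \<in> U\<close> by blast
    ultimately show "y \<in> \<Union>(V ` \<U>)" using x by blast
  qed
  moreover have "card (V ` \<U>) \<le> ?n" using card_image_le[OF U(1), of V] U(2) by linarith
  ultimately show "coverable N ?n \<eta>"
    unfolding coverable_def using U(1) opV VV by (intro exI[of _ "V ` \<U>"]) auto
qed

section \<open>Relative entropy of a composite factor map\<close>

definition log_fibre_cov ::
    "('g \<Rightarrow> 'x::topological_space \<Rightarrow> 'x) \<Rightarrow> ('x \<Rightarrow> 'y) \<Rightarrow> ('x \<times> 'x) set \<Rightarrow> 'g set \<Rightarrow> real" where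
  "log_fibre_cov \<phi> p \<eta> A = ln (real (cov_family (fibres p) (bowen_entourage \<phi> \<eta> A)))"

definition log_tube_cov ::
    "('g \<Rightarrow> 'x::topological_space \<Rightarrow> 'x) \<Rightarrow> ('g \<Rightarrow> 'y \<Rightarrow> 'y) \<Rightarrow> ('x \<Rightarrow> 'y) \<Rightarrow> ('x \<times> 'x) set \<Rightarrow> ('y \<times> 'y) set \<Rightarrow> 'g set \<Rightarrow> real" where
  "log_tube_cov \<phi> \<psi> p \<eta> \<theta> A =
     ln (real (cov_family (tubes p (bowen_entourage \<psi> \<theta> A)) (bowen_entourage \<phi> \<eta> A)))"

lemma ln_real_mono: "m \<le> n \<Longrightarrow> 0 < m \<Longrightarrow> ln (real m) \<le> ln (real n)"
  by simp

locale factor_of_compact =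
  fixes \<phi> :: "'g::{topological_group_add, t2_space} \<Rightarrow> 'x::t2_space \<Rightarrow> 'x"
    and \<psi> :: "'g \<Rightarrow> 'y::t2_space \<Rightarrow> 'y"
    and p :: "'x \<Rightarrow> 'y"
  assumes X: "compact (UNIV :: 'x set)" and Y: "compact (UNIV :: 'y set)"
    and act: "top_action \<phi>" "top_action \<psi>"
    and factor: "factor_map \<phi> \<psi> p"
begin

lemmas ent = bowen_entourage_in_entourages[OF act(1)]

lemma log_fibre_cov_subadditive:
  assumes \<eta>: "\<eta> \<in> entourages"
  shows "compact_subadditive (log_fibre_cov \<phi> p \<eta>)"
proof -
  obtain M where M: "M \<in> fibres p" "M \<noteq> {}"
    using fibres_nonempty[OF factor_mapD(2)[OF factor]] by blast
  have pos: "0 < cov_family (fibres p) (bowen_entourage \<phi> \<eta> A)" if "compact A" for A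
    by (rule cov_family_pos[OF X ent[OF that \<eta>] M])
  have tr: "cov_family (fibres p) (bowen_entourage \<phi> \<eta> ((\<lambda>a. a + g) ` A))
      \<le> cov_family (fibres p) (bowen_entourage \<phi> \<eta> A)" if "compact A" for A g
    by (rule cov_family_translate_le[OF X act(1) that \<eta>]) (rule fibres_translate[OF act factor])
  show ?thesis
    unfolding compact_subadditive_def
  proof (intro conjI allI impI)
    show "log_fibre_cov \<phi> p \<eta> {} = 0"
      by (simp add: log_fibre_cov_def cov_family_UNIV[OF X M])
  next
    fix A B :: "'g set" assume AB: "compact A" "compact B" "A \<subseteq> B"
    show "log_fibre_cov \<phi> p \<eta> A \<le> log_fibre_cov \<phi> p \<eta> B"
      unfolding log_fibre_cov_def
    proof (rule ln_real_mono)
      show "cov_family (fibres p) (bowen_entourage \<phi> \<eta> A) \<le> cov_family (fibres p) (bowen_entourage \<phi> \<eta> B)"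
        using AB by (intro cov_family_mono[OF X ent[OF AB(2) \<eta>]] bowen_entourage_mono) auto
    qed (rule pos[OF AB(1)])
  next
    fix A B :: "'g set" assume AB: "compact A" "compact B"
    show "log_fibre_cov \<phi> p \<eta> (A \<union> B) \<le> log_fibre_cov \<phi> p \<eta> A + log_fibre_cov \<phi> p \<eta> B"
      unfolding log_fibre_cov_def by (rule ln_cov_family_Un[OF X act(1) AB \<eta> subset_refl subset_refl M])
  next
    fix A :: "'g set" and g assume A: "compact A"
    have Ag: "compact ((\<lambda>a. a + g) ` A)"
      using A by (intro compact_continuous_image) (auto intro!: continuous_intros)
    have "cov_family (fibres p) (bowen_entourage \<phi> \<eta> ((\<lambda>a. a + g) ` A))
        = cov_family (fibres p) (bowen_entourage \<phi> \<eta> A)"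
      using tr[OF A, of g] tr[OF Ag, of "- g"] unfolding right_translate_back by (rule antisym)
    then show "log_fibre_cov \<phi> p \<eta> ((\<lambda>x. x + g) ` A) = log_fibre_cov \<phi> p \<eta> A"
      by (simp add: log_fibre_cov_def)
  qed
qed

lemma log_tube_cov_subadditive:
  assumes \<eta>: "\<eta> \<in> entourages" and \<theta>: "\<theta> \<in> entourages" and C: "compact C"
  shows "subadditive_invariant H (\<lambda>F. log_tube_cov \<phi> \<psi> p \<eta> \<theta> (C + F))"
proof -
  have cF: "compact (C + F)" if "finite F" for F
    using C that by (simp add: compact_set_plus finite_imp_compact)
  have ne: "\<exists>M\<in>tubes p (bowen_entourage \<psi> \<theta> A). M \<noteq> {}" if "compact A" for A
    using tubes_nonempty[OF factor_mapD(2)[OF factor] bowen_entourage_in_entourages[OF act(2) that \<theta>]] .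
  have pos: "0 < cov_family (tubes p (bowen_entourage \<psi> \<theta> A)) (bowen_entourage \<phi> \<eta> A)" if "compact A" for A
    using ne[OF that] cov_family_pos[OF X ent[OF that \<eta>]] by blast
  have tr: "cov_family (tubes p (bowen_entourage \<psi> \<theta> ((\<lambda>a. a + g) ` A))) (bowen_entourage \<phi> \<eta> ((\<lambda>a. a + g) ` A))
      \<le> cov_family (tubes p (bowen_entourage \<psi> \<theta> A)) (bowen_entourage \<phi> \<eta> A)" if "compact A" for A g
    by (rule cov_family_translate_le[OF X act(1) that \<eta>]) (rule tubes_translate[OF act factor])
  have Un: "log_tube_cov \<phi> \<psi> p \<eta> \<theta> (A \<union> B) \<le> log_tube_cov \<phi> \<psi> p \<eta> \<theta> A + log_tube_cov \<phi> \<psi> p \<eta> \<theta> B"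
    if AB: "compact A" "compact B" for A B
  proof -
    obtain M where M: "M \<in> tubes p (bowen_entourage \<psi> \<theta> (A \<union> B))" "M \<noteq> {}"
      using ne[OF compact_Un[OF AB]] by blast
    show ?thesis
      unfolding log_tube_cov_def
      by (rule ln_cov_family_Un[OF X act(1) AB \<eta> _ _ M]) (intro tubes_mono bowen_entourage_mono; auto)+
  qed
  have translate: "log_tube_cov \<phi> \<psi> p \<eta> \<theta> ((\<lambda>x. x + g) ` A) = log_tube_cov \<phi> \<psi> p \<eta> \<theta> A"
    if A: "compact A" for A g
  proof -
    have Ag: "compact ((\<lambda>a. a + g) ` A)"
      using A by (intro compact_continuous_image) (auto intro!: continuous_intros)
    have "cov_family (tubes p (bowen_entourage \<psi> \<theta> ((\<lambda>a. a + g) ` A))) (bowen_entourage \<phi> \<eta> ((\<lambda>a. a + g) ` A))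
        = cov_family (tubes p (bowen_entourage \<psi> \<theta> A)) (bowen_entourage \<phi> \<eta> A)"
      using tr[OF A, of g] tr[OF Ag, of "- g"] unfolding right_translate_back by (rule antisym)
    then show ?thesis by (simp add: log_tube_cov_def)
  qed
  obtain M where M: "M \<in> tubes p (bowen_entourage \<psi> \<theta> {})" "M \<noteq> {}"
    using ne[OF compact_empty] by blast
  have "log_tube_cov \<phi> \<psi> p \<eta> \<theta> {} = 0"
    using cov_family_UNIV[OF X M] by (simp add: log_tube_cov_def)
  moreover have "0 \<le> log_tube_cov \<phi> \<psi> p \<eta> \<theta> A" if "compact A" for A
    using pos[OF that] by (simp add: log_tube_cov_def)
  ultimately show ?thesis
    unfolding subadditive_invariant_def set_plus_right_translate set_plus_Un_right
    using cF Un translate by simp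
qed

text \<open>
  Tubes along \<open>S\<close> are contained in tubes of order \<open>\<xi>\<close> as soon as \<open>\<theta>\<close> is \<open>\<xi>\<close> moved by \<open>- s\<close>, for some
  \<open>s \<in> S\<close>. The set \<open>S\<close> must be non-empty: along the empty set, the whole space is a tube.
\<close>
lemma log_tube_cov_refine:
  assumes \<eta>: "\<eta> \<in> entourages" and S: "compact S" "S \<noteq> {}"
  obtains \<theta> where "\<theta> \<in> entourages" "log_tube_cov \<phi> \<psi> p \<eta> \<theta> S \<le> log_fibre_cov \<phi> p \<eta> S"
proof -
  obtain s where s: "s \<in> S" using S by blast
  obtain \<xi> where \<xi>: "\<xi> \<in> entourages"
    "cov_family (tubes p \<xi>) (bowen_entourage \<phi> \<eta> S) \<le> cov_family (fibres p) (bowen_entourage \<phi> \<eta> S)"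
    by (rule tubes_refine_to_fibres[OF X Y factor_mapD(1)[OF factor] ent[OF S(1) \<eta>]])
  define \<theta> where "\<theta> = bowen_entourage \<psi> \<xi> {- s}"
  have \<theta>: "\<theta> \<in> entourages"
    unfolding \<theta>_def by (rule bowen_entourage_in_entourages[OF act(2) _ \<xi>(1)]) simp
  have "bowen_entourage \<psi> \<theta> S \<subseteq> \<xi>"
    using s by (force simp: \<theta>_def bowen_entourage_def top_actionD[OF act(2)])
  then have "tubes p (bowen_entourage \<psi> \<theta> S) \<subseteq> tubes p \<xi>" by (rule tubes_mono)
  then have "cov_family (tubes p (bowen_entourage \<psi> \<theta> S)) (bowen_entourage \<phi> \<eta> S) \<le> cov_family (tubes p \<xi>) (bowen_entourage \<phi> \<eta> S)"
    by (intro cov_family_mono[OF X ent[OF S(1) \<eta>]]) auto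
  also note \<xi>(2)
  finally have le: "cov_family (tubes p (bowen_entourage \<psi> \<theta> S)) (bowen_entourage \<phi> \<eta> S) \<le> cov_family (fibres p) (bowen_entourage \<phi> \<eta> S)" .
  obtain M where M: "M \<in> tubes p (bowen_entourage \<psi> \<theta> S)" "M \<noteq> {}"
    using tubes_nonempty[OF factor_mapD(2)[OF factor] bowen_entourage_in_entourages[OF act(2) S(1) \<theta>]] by blast
  have "0 < cov_family (tubes p (bowen_entourage \<psi> \<theta> S)) (bowen_entourage \<phi> \<eta> S)"
    by (rule cov_family_pos[OF X ent[OF S(1) \<eta>] M])
  then have "log_tube_cov \<phi> \<psi> p \<eta> \<theta> S \<le> log_fibre_cov \<phi> p \<eta> S"
    unfolding log_tube_cov_def log_fibre_cov_def using le by (intro ln_real_mono)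
  then show thesis using that \<theta> by blast
qed

lemma log_tube_cov_mono:
  assumes \<eta>: "\<eta> \<in> entourages" and \<theta>: "\<theta> \<in> entourages" "\<theta> \<subseteq> \<theta>'" and S: "compact S"
  shows "log_tube_cov \<phi> \<psi> p \<eta> \<theta> S \<le> log_tube_cov \<phi> \<psi> p \<eta> \<theta>' S"
  unfolding log_tube_cov_def
proof (rule ln_real_mono)
  have "tubes p (bowen_entourage \<psi> \<theta> S) \<subseteq> tubes p (bowen_entourage \<psi> \<theta>' S)"
    using \<theta> by (intro tubes_mono bowen_entourage_mono) auto
  then show "cov_family (tubes p (bowen_entourage \<psi> \<theta> S)) (bowen_entourage \<phi> \<eta> S) \<le>
      cov_family (tubes p (bowen_entourage \<psi> \<theta>' S)) (bowen_entourage \<phi> \<eta> S)"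
    by (intro cov_family_mono[OF X ent[OF S \<eta>]]) auto
  obtain M where M: "M \<in> tubes p (bowen_entourage \<psi> \<theta> S)" "M \<noteq> {}"
    using tubes_nonempty[OF factor_mapD(2)[OF factor] bowen_entourage_in_entourages[OF act(2) S \<theta>(1)]] by blast
  show "0 < cov_family (tubes p (bowen_entourage \<psi> \<theta> S)) (bowen_entourage \<phi> \<eta> S)"
    by (rule cov_family_pos[OF X ent[OF S \<eta>] M])
qed

lemma log_enat_cov_map:
  assumes \<eta>: "\<eta> \<in> entourages" and A: "compact A"
  shows "log_enat (cov_map p (bowen_entourage \<phi> \<eta> A)) = ereal (log_fibre_cov \<phi> p \<eta> A)"
proof -
  have "cov_map p (bowen_entourage \<phi> \<eta> A) = (SUP M\<in>fibres p. cov M (bowen_entourage \<phi> \<eta> A))"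
    by (simp add: cov_map_def fibres_def image_image)
  also have "\<dots> = enat (cov_family (fibres p) (bowen_entourage \<phi> \<eta> A))"
    by (simp add: enat_cov_family[OF X ent[OF A \<eta>]])
  finally have eq: "cov_map p (bowen_entourage \<phi> \<eta> A) = enat (cov_family (fibres p) (bowen_entourage \<phi> \<eta> A))" .
  obtain M where M: "M \<in> fibres p" "M \<noteq> {}"
    using fibres_nonempty[OF factor_mapD(2)[OF factor]] by blast
  have "0 < cov_family (fibres p) (bowen_entourage \<phi> \<eta> A)" by (rule cov_family_pos[OF X ent[OF A \<eta>] M])
  then show ?thesis unfolding eq by (simp add: log_enat_def log_fibre_cov_def)
qed

end

lemma (in factor_of_compact) log_fibre_cov_le_composite:
  assumes \<eta>: "\<eta> \<in> entourages" and S: "compact S"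
  shows "log_fibre_cov \<phi> p \<eta> S \<le> log_fibre_cov \<phi> (q \<circ> p) \<eta> S"
  unfolding log_fibre_cov_def
proof (rule ln_real_mono)
  have "\<exists>N\<in>fibres (q \<circ> p). M \<subseteq> N" if "M \<in> fibres p" for M
    using that by (auto simp: fibres_def)
  then show "cov_family (fibres p) (bowen_entourage \<phi> \<eta> S) \<le> cov_family (fibres (q \<circ> p)) (bowen_entourage \<phi> \<eta> S)"
    by (intro cov_family_mono[OF X ent[OF S \<eta>]]) auto
  obtain M where M: "M \<in> fibres p" "M \<noteq> {}"
    using fibres_nonempty[OF factor_mapD(2)[OF factor]] by blast
  show "0 < cov_family (fibres p) (bowen_entourage \<phi> \<eta> S)" by (rule cov_family_pos[OF X ent[OF S \<eta>] M])
qed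

lemma log_fibre_cov_composite:
  assumes p: "factor_of_compact \<phi> \<psi> p" and q: "factor_of_compact \<psi> \<rho> q"
    and qp: "factor_of_compact \<phi> \<rho> (q \<circ> p)"
    and \<eta>: "\<eta> \<in> entourages" and \<theta>: "\<theta> \<in> entourages" and S: "compact S"
  shows "log_fibre_cov \<phi> (q \<circ> p) \<eta> S \<le> log_fibre_cov \<psi> q \<theta> S + log_tube_cov \<phi> \<psi> p \<eta> \<theta> S"
proof -
  interpret p: factor_of_compact \<phi> \<psi> p by (rule p)
  interpret q: factor_of_compact \<psi> \<rho> q by (rule q)
  interpret qp: factor_of_compact \<phi> \<rho> "q \<circ> p" by (rule qp)
  let ?a = "cov_family (fibres (q \<circ> p)) (bowen_entourage \<phi> \<eta> S)"
  let ?b = "cov_family (fibres q) (bowen_entourage \<psi> \<theta> S)"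
  let ?c = "cov_family (tubes p (bowen_entourage \<psi> \<theta> S)) (bowen_entourage \<phi> \<eta> S)"
  note entp = p.ent[OF S \<eta>] and entq = q.ent[OF S \<theta>]
  have le: "?a \<le> ?b * ?c" by (rule cov_family_composite[OF p.X p.Y entp entq])
  obtain M where "M \<in> fibres (q \<circ> p)" "M \<noteq> {}"
    using fibres_nonempty[OF factor_mapD(2)[OF qp.factor]] by blast
  then have "0 < ?a" by (rule cov_family_pos[OF p.X entp])
  then have pos: "0 < ?a" "0 < ?b" "0 < ?c" using le by (auto intro!: Nat.gr0I)
  have "ln (real ?a) \<le> ln (real (?b * ?c))" using le pos(1) by (rule ln_real_mono)
  also have "\<dots> = ln (real ?b) + ln (real ?c)" using pos by (simp add: ln_mult)
  finally show ?thesis by (simp add: log_fibre_cov_def log_tube_cov_def)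
qed

text \<open>
  Halving \<open>\<eta>\<close> twice gives a symmetric \<open>\<theta>\<close> whose triple composition lies in \<open>\<eta>\<close>; its preimage under
  \<open>p\<close> is the required entourage, for all \<open>S\<close> at once.
\<close>
lemma log_fibre_cov_factor:
  assumes p: "factor_of_compact \<phi> \<psi> p" and q: "factor_of_compact \<psi> \<rho> q"
    and \<eta>: "\<eta> \<in> entourages"
  obtains \<zeta> where "\<zeta> \<in> entourages"
    "\<And>S. compact S \<Longrightarrow> log_fibre_cov \<psi> q \<eta> S \<le> log_fibre_cov \<phi> (q \<circ> p) \<zeta> S"
proof -
  interpret p: factor_of_compact \<phi> \<psi> p by (rule p)
  interpret q: factor_of_compact \<psi> \<rho> q by (rule q)
  obtain V where V: "open V" "range (\<lambda>x. (x, x)) \<subseteq> V" "sym V" "V O V \<subseteq> \<eta>"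
    by (rule entourage_half[OF p.Y \<eta>])
  have Vent: "V \<in> entourages" using V by (auto simp: entourages_def)
  obtain \<theta> where \<theta>: "open \<theta>" "range (\<lambda>x. (x, x)) \<subseteq> \<theta>" "sym \<theta>" "\<theta> O \<theta> \<subseteq> V"
    by (rule entourage_half[OF p.Y Vent])
  have \<theta>ent: "\<theta> \<in> entourages" using \<theta> by (auto simp: entourages_def)
  have comp: "(a, d) \<in> \<eta>" if "(b, a) \<in> \<theta>" "(b, c) \<in> \<theta>" "(c, d) \<in> \<theta>" for a b c d
  proof -
    have "(a, b) \<in> \<theta>" using that(1) \<theta>(3) by (auto simp: sym_def)
    then have "(a, c) \<in> V" using that(2) \<theta>(4) by blast
    moreover have "(c, d) \<in> \<theta> O \<theta>" using that(3) \<theta>(2) by blast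
    then have "(c, d) \<in> V" using \<theta>(4) by blast
    ultimately show ?thesis using V(4) by blast
  qed
  define \<zeta> where "\<zeta> = (\<lambda>z. (p (fst z), p (snd z))) -` \<theta>"
  have cp: "continuous_on UNIV p" using factor_mapD(1)[OF p.factor] .
  have "open \<zeta>"
    unfolding \<zeta>_def using \<theta>(1)
    by (intro open_vimage continuous_on_Pair continuous_on_compose2[OF cp])
      (auto intro!: continuous_intros)
  moreover have "range (\<lambda>x. (x, x)) \<subseteq> \<zeta>"
    unfolding \<zeta>_def using subsetD[OF \<theta>(2) rangeI] by auto
  ultimately have \<zeta>: "\<zeta> \<in> entourages" unfolding entourages_def by blast
  have "log_fibre_cov \<psi> q \<eta> S \<le> log_fibre_cov \<phi> (q \<circ> p) \<zeta> S" if S: "compact S" for S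
    unfolding log_fibre_cov_def
  proof (rule ln_real_mono)
    show "cov_family (fibres q) (bowen_entourage \<psi> \<eta> S) \<le> cov_family (fibres (q \<circ> p)) (bowen_entourage \<phi> \<zeta> S)"
    proof (rule cov_family_of_factor_le[OF p.X p.Y factor_mapD(2)[OF p.factor] p.ent[OF S \<zeta>] q.ent[OF S \<theta>ent] q.ent[OF S \<eta>]])
      show "(p x, p x') \<in> bowen_entourage \<psi> \<theta> S" if "(x, x') \<in> bowen_entourage \<phi> \<zeta> S" for x x'
        using that by (simp add: bowen_entourage_def \<zeta>_def factor_mapD(3)[OF p.factor])
      show "(bowen_entourage \<psi> \<theta> S)\<inverse> O bowen_entourage \<psi> \<theta> S O bowen_entourage \<psi> \<theta> S \<subseteq> bowen_entourage \<psi> \<eta> S"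
        using comp by (fastforce simp: bowen_entourage_def)
    qed
    obtain M where M: "M \<in> fibres q" "M \<noteq> {}"
      using fibres_nonempty[OF factor_mapD(2)[OF q.factor]] by blast
    show "0 < cov_family (fibres q) (bowen_entourage \<psi> \<eta> S)" by (rule cov_family_pos[OF p.Y q.ent[OF S \<eta>] M])
  qed
  then show thesis using that[OF \<zeta>] by blast
qed

context lattice_domain
begin

lemma domain_nonempty: "C \<noteq> {}" using D_interior D_subset interior_subset by fastforce

lemma log_fibre_cov_lattice_limit:
  assumes "factor_of_compact \<phi> \<psi> p" "\<eta> \<in> entourages"
  obtains L where "((\<lambda>F. log_fibre_cov \<phi> p \<eta> (C + F) / real (card F)) \<longlongrightarrow> L) (folner \<Lambda>)"
  using ornstein_weiss[OF subgroup compact_subadditive_imp_subadditive_invariant[OF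
      factor_of_compact.log_fibre_cov_subadditive[OF assms] C_compact]] .

text \<open>
  The limit in the definition of entropy exists, and it is the limit over the lattice divided by the
  covolume. Hence inequalities between entropies can be checked on finite subsets of the lattice.
\<close>
lemma Lim_log_cov_eq_lattice_limit:
  fixes A :: "'i::order \<Rightarrow> 'g set"
  assumes vH: "van_hove_net \<mu> A" and fac: "factor_of_compact \<phi> \<psi> p" and \<eta>: "\<eta> \<in> entourages"
    and L: "((\<lambda>F. log_fibre_cov \<phi> p \<eta> (C + F) / real (card F)) \<longlongrightarrow> L) (folner \<Lambda>)"
  shows "Lim at_top (\<lambda>i. log_enat (cov_map p (bowen_entourage \<phi> \<eta> (A i))) / ereal (measure \<mu> (A i)))
      = ereal (L / measure \<mu> D)"
proof (rule tendsto_Lim[OF at_top_nontrivial[OF vH]])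
  interpret factor_of_compact \<phi> \<psi> p by (rule fac)
  have "((\<lambda>i. ereal (log_fibre_cov \<phi> p \<eta> (A i) / measure \<mu> (A i))) \<longlongrightarrow> ereal (L / measure \<mu> D)) at_top"
    using van_hove_limit[OF vH log_fibre_cov_subadditive[OF \<eta>] L] by simp
  moreover have "eventually (\<lambda>i. ereal (log_fibre_cov \<phi> p \<eta> (A i) / measure \<mu> (A i)) =
      log_enat (cov_map p (bowen_entourage \<phi> \<eta> (A i))) / ereal (measure \<mu> (A i))) at_top"
    using net_measure_pos[OF vH]
    by (rule eventually_mono) (simp add: log_enat_cov_map[OF \<eta> net_compact[OF vH]])
  ultimately show "((\<lambda>i. log_enat (cov_map p (bowen_entourage \<phi> \<eta> (A i))) / ereal (measure \<mu> (A i)))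
      \<longlongrightarrow> ereal (L / measure \<mu> D)) at_top" by (rule Lim_transform_eventually)
qed

lemma lattice_limit_le_rel_entropy:
  fixes A :: "'i::order \<Rightarrow> 'g set"
  assumes vH: "van_hove_net \<mu> A" and fac: "factor_of_compact \<phi> \<psi> p" and \<eta>: "\<eta> \<in> entourages"
    and L: "((\<lambda>F. log_fibre_cov \<phi> p \<eta> (C + F) / real (card F)) \<longlongrightarrow> L) (folner \<Lambda>)"
  shows "ereal (L / measure \<mu> D) \<le> rel_entropy \<mu> A \<phi> p"
  unfolding rel_entropy_def Lim_log_cov_eq_lattice_limit[OF assms, symmetric] using \<eta> by (rule SUP_upper)

lemma rel_entropy_leI:
  fixes A :: "'i::order \<Rightarrow> 'g set" and \<phi> :: "'g \<Rightarrow> 'x::t2_space \<Rightarrow> 'x"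
  assumes vH: "van_hove_net \<mu> A" and fac: "factor_of_compact \<phi> \<psi> p"
    and le: "\<And>\<eta> L. \<eta> \<in> entourages \<Longrightarrow>
      ((\<lambda>F. log_fibre_cov \<phi> p \<eta> (C + F) / real (card F)) \<longlongrightarrow> L) (folner \<Lambda>) \<Longrightarrow> ereal (L / measure \<mu> D) \<le> b"
  shows "rel_entropy \<mu> A \<phi> p \<le> b"
  unfolding rel_entropy_def
proof (rule SUP_least)
  fix \<eta> :: "('x \<times> 'x) set" assume \<eta>: "\<eta> \<in> entourages"
  obtain L where L: "((\<lambda>F. log_fibre_cov \<phi> p \<eta> (C + F) / real (card F)) \<longlongrightarrow> L) (folner \<Lambda>)"
    by (rule log_fibre_cov_lattice_limit[OF fac \<eta>])
  show "Lim at_top (\<lambda>i. log_enat (cov_map p (bowen_entourage \<phi> \<eta> (A i))) / ereal (measure \<mu> (A i))) \<le> b"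
    unfolding Lim_log_cov_eq_lattice_limit[OF vH fac \<eta> L] by (rule le[OF \<eta> L])
qed

lemma eventually_folner_finite: "eventually (\<lambda>F. finite F \<and> F \<subseteq> \<Lambda> \<and> F \<noteq> {}) (folner \<Lambda>)"
  unfolding eventually_folner
  by (rule exI[of _ "{}"], rule exI[of _ 1]) (auto simp: invariant_sets_def)

lemma compact_C_plus: "finite F \<Longrightarrow> compact (C + F)"
  using C_compact by (simp add: compact_set_plus finite_imp_compact)

text \<open>
  Let \<open>L'\<close> be the number that the Ornstein--Weiss lemma assigns to the functions
  \<open>log_tube_cov \<phi> \<psi> p \<eta> \<theta>\<close>, indexed by \<open>\<theta>\<close>. If \<open>L < L'\<close>, some invariant \<open>F\<close> has a fibre covering
  number of rate below \<open>l\<close> and tube covering numbers of rate above \<open>l\<close> for all \<open>\<theta>\<close>, although for a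
  suitable \<open>\<theta>\<close> the second is at most the first. So \<open>L' \<le> L\<close>, and a single \<open>\<theta>\<close> serves all
  sufficiently invariant \<open>F\<close>.
\<close>
lemma log_tube_cov_asymptotics:
  assumes fac: "factor_of_compact \<phi> \<psi> p" and \<eta>: "\<eta> \<in> entourages" and nontriv: "folner \<Lambda> \<noteq> bot"
    and L: "((\<lambda>F. log_fibre_cov \<phi> p \<eta> (C + F) / real (card F)) \<longlongrightarrow> L) (folner \<Lambda>)" and a: "L < a"
  obtains \<theta> where "\<theta> \<in> entourages"
    "eventually (\<lambda>F. log_tube_cov \<phi> \<psi> p \<eta> \<theta> (C + F) \<le> a * real (card F)) (folner \<Lambda>)"
proof -
  interpret factor_of_compact \<phi> \<psi> p by (rule fac)
  let ?\<F> = "(\<lambda>\<theta> F. log_tube_cov \<phi> \<psi> p \<eta> \<theta> (C + F)) ` entourages"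
  obtain L' where up: "\<And>a. L' < a \<Longrightarrow> \<exists>f\<in>?\<F>. eventually (\<lambda>F. f F \<le> a * real (card F)) (folner \<Lambda>)"
    and low: "\<And>l. l < L' \<Longrightarrow> eventually (\<lambda>F. \<forall>f\<in>?\<F>. l * real (card F) < f F) (folner \<Lambda>)"
  proof (rule ornstein_weiss_family[OF subgroup, of ?\<F>])
    fix L' assume "\<And>a. L' < a \<Longrightarrow> \<exists>f\<in>?\<F>. eventually (\<lambda>F. f F \<le> a * real (card F)) (folner \<Lambda>)"
      "\<And>l. l < L' \<Longrightarrow> eventually (\<lambda>F. \<forall>f\<in>?\<F>. l * real (card F) < f F) (folner \<Lambda>)"
    then show thesis by (rule that)
  next
    show "?\<F> \<noteq> {}" using entourages_UNIV by blast
    show "subadditive_invariant \<Lambda> f" if "f \<in> ?\<F>" for f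
      using that log_tube_cov_subadditive[OF \<eta> _ C_compact] by blast
    show "\<exists>h\<in>?\<F>. \<forall>F. finite F \<longrightarrow> F \<subseteq> \<Lambda> \<longrightarrow> h F \<le> f F \<and> h F \<le> g F"
      if fg: "f \<in> ?\<F>" "g \<in> ?\<F>" for f g
    proof -
      obtain \<theta> \<theta>' where \<theta>: "\<theta> \<in> entourages" "\<theta>' \<in> entourages"
        "f = (\<lambda>F. log_tube_cov \<phi> \<psi> p \<eta> \<theta> (C + F))" "g = (\<lambda>F. log_tube_cov \<phi> \<psi> p \<eta> \<theta>' (C + F))"
        using fg by blast
      show ?thesis
        unfolding \<theta>(3,4)
        by (intro bexI[of _ "\<lambda>F. log_tube_cov \<phi> \<psi> p \<eta> (\<theta> \<inter> \<theta>') (C + F)"] allI impI conjI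
            log_tube_cov_mono[OF \<eta> entourages_Int[OF \<theta>(1,2)]] compact_C_plus imageI entourages_Int \<theta>(1,2)) auto
    qed
  qed
  have "L' \<le> L"
  proof (rule ccontr)
    assume "\<not> L' \<le> L"
    then obtain l where l: "L < l" "l < L'" using dense[of L L'] by auto
    have "eventually (\<lambda>F. log_fibre_cov \<phi> p \<eta> (C + F) / real (card F) < l) (folner \<Lambda>)"
      using L l(1) by (rule order_tendstoD(2))
    from eventually_happens'[OF nontriv eventually_conj[OF eventually_folner_finite eventually_conj[OF this low[OF l(2)]]]]
    obtain F where F: "finite F" "F \<noteq> {}" "log_fibre_cov \<phi> p \<eta> (C + F) / real (card F) < l"
      "\<forall>f\<in>?\<F>. l * real (card F) < f F" by blast
    have "C + F \<noteq> {}" using domain_nonempty F(2) by (auto simp: set_plus_def)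
    then obtain \<theta> where \<theta>: "\<theta> \<in> entourages"
      "log_tube_cov \<phi> \<psi> p \<eta> \<theta> (C + F) \<le> log_fibre_cov \<phi> p \<eta> (C + F)"
      using log_tube_cov_refine[OF \<eta> compact_C_plus[OF F(1)]] by blast
    have "l * real (card F) < log_tube_cov \<phi> \<psi> p \<eta> \<theta> (C + F)" by (rule bspec[OF F(4) imageI[OF \<theta>(1)]])
    moreover have "log_fibre_cov \<phi> p \<eta> (C + F) < l * real (card F)"
      using F by (simp add: pos_divide_less_eq card_gt_0_iff)
    ultimately show False using \<theta>(2) by linarith
  qed
  then show thesis using up[of a] a that by fastforce
qed

theorem rel_entropy_composite_le_add:
  fixes A :: "'i::order \<Rightarrow> 'g set"
  assumes vH: "van_hove_net \<mu> A" and p: "factor_of_compact \<phi> \<psi> p" and q: "factor_of_compact \<psi> \<rho> q"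
    and qp: "factor_of_compact \<phi> \<rho> (q \<circ> p)"
  shows "rel_entropy \<mu> A \<phi> (q \<circ> p) \<le> rel_entropy \<mu> A \<phi> p + rel_entropy \<mu> A \<psi> q"
proof (rule rel_entropy_leI[OF vH qp])
  interpret p: factor_of_compact \<phi> \<psi> p by (rule p)
  interpret q: factor_of_compact \<psi> \<rho> q by (rule q)
  interpret qp: factor_of_compact \<phi> \<rho> "q \<circ> p" by (rule qp)
  note nontriv = folner_nontrivial[OF vH]
  fix \<eta> L
  assume \<eta>: "\<eta> \<in> entourages"
    and L: "((\<lambda>F. log_fibre_cov \<phi> (q \<circ> p) \<eta> (C + F) / real (card F)) \<longlongrightarrow> L) (folner \<Lambda>)"
  obtain Lp where Lp: "((\<lambda>F. log_fibre_cov \<phi> p \<eta> (C + F) / real (card F)) \<longlongrightarrow> Lp) (folner \<Lambda>)"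
    by (rule log_fibre_cov_lattice_limit[OF p \<eta>])
  show "ereal (L / measure \<mu> D) \<le> rel_entropy \<mu> A \<phi> p + rel_entropy \<mu> A \<psi> q"
  proof (rule ereal_le_epsilon2)
    fix e :: real assume e: "0 < e"
    have "Lp < Lp + e * measure \<mu> D" using e measure_D_pos by simp
    then obtain \<theta> where \<theta>: "\<theta> \<in> entourages"
      and ev: "eventually (\<lambda>F. log_tube_cov \<phi> \<psi> p \<eta> \<theta> (C + F) \<le> (Lp + e * measure \<mu> D) * real (card F)) (folner \<Lambda>)"
      using log_tube_cov_asymptotics[OF p \<eta> nontriv Lp] by blast
    obtain Lq where Lq: "((\<lambda>F. log_fibre_cov \<psi> q \<theta> (C + F) / real (card F)) \<longlongrightarrow> Lq) (folner \<Lambda>)"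
      by (rule log_fibre_cov_lattice_limit[OF q \<theta>])
    have "L \<le> Lq + (Lp + e * measure \<mu> D)"
    proof (rule tendsto_le[OF nontriv _ L])
      show "((\<lambda>F. log_fibre_cov \<psi> q \<theta> (C + F) / real (card F) + (Lp + e * measure \<mu> D))
          \<longlongrightarrow> Lq + (Lp + e * measure \<mu> D)) (folner \<Lambda>)" by (intro tendsto_add Lq tendsto_const)
      show "eventually (\<lambda>F. log_fibre_cov \<phi> (q \<circ> p) \<eta> (C + F) / real (card F)
          \<le> log_fibre_cov \<psi> q \<theta> (C + F) / real (card F) + (Lp + e * measure \<mu> D)) (folner \<Lambda>)"
        using eventually_conj[OF eventually_folner_finite ev]
      proof (rule eventually_mono)
        fix F assume F: "(finite F \<and> F \<subseteq> \<Lambda> \<and> F \<noteq> {}) \<and>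
          log_tube_cov \<phi> \<psi> p \<eta> \<theta> (C + F) \<le> (Lp + e * measure \<mu> D) * real (card F)"
        then have S: "compact (C + F)" and card: "0 < real (card F)"
          by (auto intro: compact_C_plus simp: card_gt_0_iff)
        have "log_fibre_cov \<phi> (q \<circ> p) \<eta> (C + F) \<le> log_fibre_cov \<psi> q \<theta> (C + F) + log_tube_cov \<phi> \<psi> p \<eta> \<theta> (C + F)"
          by (rule log_fibre_cov_composite[OF p q qp \<eta> \<theta> S])
        also have "\<dots> \<le> log_fibre_cov \<psi> q \<theta> (C + F) + (Lp + e * measure \<mu> D) * real (card F)"
          using F by simp
        finally show "log_fibre_cov \<phi> (q \<circ> p) \<eta> (C + F) / real (card F)
          \<le> log_fibre_cov \<psi> q \<theta> (C + F) / real (card F) + (Lp + e * measure \<mu> D)"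
          using card by (simp add: field_simps)
      qed
    qed
    then have "L / measure \<mu> D \<le> (Lq + (Lp + e * measure \<mu> D)) / measure \<mu> D"
      using measure_D_pos by (intro divide_right_mono) auto
    also have "\<dots> = Lp / measure \<mu> D + Lq / measure \<mu> D + e"
      using measure_D_pos by (simp add: field_simps)
    finally have "ereal (L / measure \<mu> D) \<le> ereal (Lp / measure \<mu> D) + ereal (Lq / measure \<mu> D) + ereal e" by simp
    also have "\<dots> \<le> rel_entropy \<mu> A \<phi> p + rel_entropy \<mu> A \<psi> q + ereal e"
      by (intro add_mono order_refl lattice_limit_le_rel_entropy[OF vH p \<eta> Lp] lattice_limit_le_rel_entropy[OF vH q \<theta> Lq])
    finally show "ereal (L / measure \<mu> D) \<le> rel_entropy \<mu> A \<phi> p + rel_entropy \<mu> A \<psi> q + ereal e" .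
  qed
qed

theorem rel_entropy_le_composite:
  fixes A :: "'i::order \<Rightarrow> 'g set"
  assumes vH: "van_hove_net \<mu> A" and p: "factor_of_compact \<phi> \<psi> p"
    and qp: "factor_of_compact \<phi> \<rho> (q \<circ> p)"
  shows "rel_entropy \<mu> A \<phi> p \<le> rel_entropy \<mu> A \<phi> (q \<circ> p)"
proof (rule rel_entropy_leI[OF vH p])
  interpret p: factor_of_compact \<phi> \<psi> p by (rule p)
  fix \<eta> L
  assume \<eta>: "\<eta> \<in> entourages"
    and L: "((\<lambda>F. log_fibre_cov \<phi> p \<eta> (C + F) / real (card F)) \<longlongrightarrow> L) (folner \<Lambda>)"
  obtain L' where L': "((\<lambda>F. log_fibre_cov \<phi> (q \<circ> p) \<eta> (C + F) / real (card F)) \<longlongrightarrow> L') (folner \<Lambda>)"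
    by (rule log_fibre_cov_lattice_limit[OF qp \<eta>])
  have "L \<le> L'"
  proof (rule tendsto_le[OF folner_nontrivial[OF vH] L' L])
    show "eventually (\<lambda>F. log_fibre_cov \<phi> p \<eta> (C + F) / real (card F)
        \<le> log_fibre_cov \<phi> (q \<circ> p) \<eta> (C + F) / real (card F)) (folner \<Lambda>)"
      using eventually_folner_finite
    proof (rule eventually_mono)
      fix F assume F: "finite F \<and> F \<subseteq> \<Lambda> \<and> F \<noteq> {}"
      then have "log_fibre_cov \<phi> p \<eta> (C + F) \<le> log_fibre_cov \<phi> (q \<circ> p) \<eta> (C + F)"
        by (intro p.log_fibre_cov_le_composite \<eta> compact_C_plus) auto
      then show "log_fibre_cov \<phi> p \<eta> (C + F) / real (card F)
          \<le> log_fibre_cov \<phi> (q \<circ> p) \<eta> (C + F) / real (card F)" by (rule divide_right_mono) simp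
    qed
  qed
  then have "ereal (L / measure \<mu> D) \<le> ereal (L' / measure \<mu> D)"
    using measure_D_pos by (simp add: divide_right_mono)
  also have "\<dots> \<le> rel_entropy \<mu> A \<phi> (q \<circ> p)" by (rule lattice_limit_le_rel_entropy[OF vH qp \<eta> L'])
  finally show "ereal (L / measure \<mu> D) \<le> rel_entropy \<mu> A \<phi> (q \<circ> p)" .
qed

theorem rel_entropy_factor_le_composite:
  fixes A :: "'i::order \<Rightarrow> 'g set"
  assumes vH: "van_hove_net \<mu> A" and p: "factor_of_compact \<phi> \<psi> p" and q: "factor_of_compact \<psi> \<rho> q"
    and qp: "factor_of_compact \<phi> \<rho> (q \<circ> p)"
  shows "rel_entropy \<mu> A \<psi> q \<le> rel_entropy \<mu> A \<phi> (q \<circ> p)"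
proof (rule rel_entropy_leI[OF vH q])
  fix \<eta> L
  assume \<eta>: "\<eta> \<in> entourages"
    and L: "((\<lambda>F. log_fibre_cov \<psi> q \<eta> (C + F) / real (card F)) \<longlongrightarrow> L) (folner \<Lambda>)"
  obtain \<zeta> where \<zeta>: "\<zeta> \<in> entourages"
    and le: "\<And>S. compact S \<Longrightarrow> log_fibre_cov \<psi> q \<eta> S \<le> log_fibre_cov \<phi> (q \<circ> p) \<zeta> S"
    by (rule log_fibre_cov_factor[OF p q \<eta>]) metis
  obtain L' where L': "((\<lambda>F. log_fibre_cov \<phi> (q \<circ> p) \<zeta> (C + F) / real (card F)) \<longlongrightarrow> L') (folner \<Lambda>)"
    by (rule log_fibre_cov_lattice_limit[OF qp \<zeta>])
  have "L \<le> L'"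
  proof (rule tendsto_le[OF folner_nontrivial[OF vH] L' L])
    show "eventually (\<lambda>F. log_fibre_cov \<psi> q \<eta> (C + F) / real (card F)
        \<le> log_fibre_cov \<phi> (q \<circ> p) \<zeta> (C + F) / real (card F)) (folner \<Lambda>)"
      using eventually_folner_finite
      by (rule eventually_mono) (intro divide_right_mono le compact_C_plus; simp)
  qed
  then have "ereal (L / measure \<mu> D) \<le> ereal (L' / measure \<mu> D)"
    using measure_D_pos by (simp add: divide_right_mono)
  also have "\<dots> \<le> rel_entropy \<mu> A \<phi> (q \<circ> p)" by (rule lattice_limit_le_rel_entropy[OF vH qp \<zeta> L'])
  finally show "ereal (L / measure \<mu> D) \<le> rel_entropy \<mu> A \<phi> (q \<circ> p)" .
qed

end

theorem theorem1p5:
  fixes \<mu> :: "'g::{topological_group_add, t2_space} measure"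
    and A :: "'i::order \<Rightarrow> 'g set"
    and \<Lambda> :: "'g set"
    and \<phi> :: "'g \<Rightarrow> 'x::t2_space \<Rightarrow> 'x"
    and \<psi> :: "'g \<Rightarrow> 'y::t2_space \<Rightarrow> 'y"
    and \<rho> :: "'g \<Rightarrow> 'z::t2_space \<Rightarrow> 'z"
    and p :: "'x \<Rightarrow> 'y"
    and q :: "'y \<Rightarrow> 'z"
  assumes "locally_compact_space (euclidean :: 'g topology)"
    and "haar_measure \<mu>"
    and "van_hove_net \<mu> A"
    and "uniform_lattice \<Lambda>" and "countable \<Lambda>"
    and "compact (UNIV :: 'x set)" and "compact (UNIV :: 'y set)" and "compact (UNIV :: 'z set)"
    and "top_action \<phi>" and "top_action \<psi>" and "top_action \<rho>"
    and "factor_map \<phi> \<psi> p" and "factor_map \<psi> \<rho> q"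
  shows "max (rel_entropy \<mu> A \<phi> p) (rel_entropy \<mu> A \<psi> q) \<le> rel_entropy \<mu> A \<phi> (q \<circ> p) \<and>
         rel_entropy \<mu> A \<phi> (q \<circ> p) \<le> rel_entropy \<mu> A \<phi> p + rel_entropy \<mu> A \<psi> q"
proof (intro conjI max.boundedI)
  obtain D C where DC: "D \<in> sets borel" "D \<subseteq> C" "compact C" "interior D \<noteq> {}"
    "\<And>x. \<exists>!s. s \<in> \<Lambda> \<and> x - s \<in> D"
    using uniform_lattice_fundamental_domain[OF assms(1,4)] by metis
  interpret lattice_domain \<mu> \<Lambda> D C
    using assms(2,4) DC by unfold_locales (auto simp: uniform_lattice_def)
  have p: "factor_of_compact \<phi> \<psi> p" and q: "factor_of_compact \<psi> \<rho> q"
    using assms by (simp_all add: factor_of_compact_def)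
  have "continuous_on UNIV (q \<circ> p)"
    using factor_mapD(1)[OF assms(12)]
    by (rule continuous_on_compose) (rule continuous_on_subset[OF factor_mapD(1)[OF assms(13)] subset_UNIV])
  moreover have "surj (q \<circ> p)"
    using factor_mapD(2)[OF assms(12)] factor_mapD(2)[OF assms(13)] by (rule comp_surj)
  ultimately have "factor_map \<phi> \<rho> (q \<circ> p)"
    unfolding factor_map_def
    by (simp add: fun_eq_iff factor_mapD(3)[OF assms(12)] factor_mapD(3)[OF assms(13)])
  then have qp: "factor_of_compact \<phi> \<rho> (q \<circ> p)"
    using assms by (simp add: factor_of_compact_def)
  show "rel_entropy \<mu> A \<phi> p \<le> rel_entropy \<mu> A \<phi> (q \<circ> p)"
    by (rule rel_entropy_le_composite[OF assms(3) p qp])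
  show "rel_entropy \<mu> A \<psi> q \<le> rel_entropy \<mu> A \<phi> (q \<circ> p)"
    by (rule rel_entropy_factor_le_composite[OF assms(3) p q qp])
  show "rel_entropy \<mu> A \<phi> (q \<circ> p) \<le> rel_entropy \<mu> A \<phi> p + rel_entropy \<mu> A \<psi> q"
    by (rule rel_entropy_composite_le_add[OF assms(3) p q qp])
qed

end
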